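(* For $\alpha\nearrow 1$ we have $$f(\alpha)=\frac12+\Theta\left(\frac{\log\log\left(1/(1-\alpha)\right)}{\log\left(1/(1-\alpha)\right)}\right),$$ that is, there exist constants $0<c_1\le c_2$ such that for all $\alpha<1$ in some left neighbourhood of $1$, $$c_1\,\frac{\log\log(1/(1-\alpha))}{\log(1/(1-\alpha))}\le f(\alpha)-\frac12\le c_2\,\frac{\log\log(1/(1-\alpha))}{\log(1/(1-\alpha))}.$$
   Context: Let $\mathbb{I}:=(0,1)\setminus\mathbb{Q}$. For $x\in\mathbb{I}$ let $(a_i(x))_{i\in\mathbb{N}}$ be the digits of its regular continued fraction expansion $x=1/(a_1(x)+1/(a_2(x)+\cdots))$, and let $q_n(x)$ be the denominator of the $n$-th convergent, so $q_n(x)=a_n(x)q_{n-1}(x)+q_{n-2}(x)$ with $q_{-1}=0$, $q_0=1$. For $\alpha\in\mathbb{R}$ let $$\mathcal{F}_\alpha:=\left\{x\in\mathbb{I}:\lim_{n\to\infty}\frac{\log\prod_{i=1}^n a_i(x)}{\log q_n(x)}=\alpha\right\},\qquad f(\alpha):=\dim_H(\mathcal{F}_\alpha),$$ where $\dim_H$ is Hausdorff dimension. *)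

theory Defs
  imports "HOL-Analysis.Analysis"
begin

section \<open>Hausdorff measure and Hausdorff dimension\<close>

text \<open>
  The conventions \<open>(diam {})^s = 0\<close> for every \<open>s\<close> and \<open>(diam U)^0 = 1\<close> for nonempty \<open>U\<close>
  are spelled out because \<open>0 powr 0 = 0\<close>; with them the 0-dimensional Hausdorff measure
  is the counting measure.
\<close>

definition diam_power :: "real \<Rightarrow> 'a::metric_space set \<Rightarrow> ennreal" where
  "diam_power s U =
     (if U = {} then 0 else if s = 0 then 1 else ennreal (diameter U powr s))"

text \<open>Boundedness is required explicitly since \<open>diameter\<close> is unspecified on unbounded sets.\<close>

definition delta_covers :: "real \<Rightarrow> 'a::metric_space set \<Rightarrow> (nat \<Rightarrow> 'a set) set" where
  "delta_covers \<delta> A =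
     {U. A \<subseteq> (\<Union>i. U i) \<and> (\<forall>i. bounded (U i) \<and> diameter (U i) \<le> \<delta>)}"

definition hausdorff_premeasure :: "real \<Rightarrow> real \<Rightarrow> 'a::metric_space set \<Rightarrow> ennreal" where
  "hausdorff_premeasure s \<delta> A = (INF U\<in>delta_covers \<delta> A. \<Sum>i. diam_power s (U i))"

text \<open>
  The premeasure increases as \<open>\<delta>\<close> decreases, so its limit for \<open>\<delta> \<rightarrow> 0\<close> is a supremum.
\<close>

definition hausdorff_measure :: "real \<Rightarrow> 'a::metric_space set \<Rightarrow> ennreal" where
  "hausdorff_measure s A = (SUP \<delta>\<in>{0<..}. hausdorff_premeasure s \<delta> A)"

definition hausdorff_dim :: "'a::metric_space set \<Rightarrow> ereal" where
  "hausdorff_dim A = (INF s\<in>{s. 0 \<le> s \<and> hausdorff_measure s A = 0}. ereal s)"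

section \<open>Regular continued fractions\<close>

definition unit_irrationals :: "real set" where
  "unit_irrationals = {0<..<1} - \<rat>"

definition gauss_map :: "real \<Rightarrow> real" where
  "gauss_map x = frac (1 / x)"

text \<open>The digits are indexed from \<open>n = 1\<close>; the value at \<open>n = 0\<close> is meaningless.\<close>

definition cf_digit :: "real \<Rightarrow> nat \<Rightarrow> nat" where
  "cf_digit x n = nat \<lfloor>1 / (gauss_map ^^ (n - 1)) x\<rfloor>"

text \<open>The second equation is the recurrence at \<open>n = 1\<close> with \<open>q\<^sub>-\<^sub>1 = 0\<close> and \<open>q\<^sub>0 = 1\<close>.\<close>

fun cf_denom :: "real \<Rightarrow> nat \<Rightarrow> nat" where
  "cf_denom x 0 = 1"
| "cf_denom x (Suc 0) = cf_digit x 1"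
| "cf_denom x (Suc (Suc n)) =
     cf_digit x (Suc (Suc n)) * cf_denom x (Suc n) + cf_denom x n"

text \<open>
  The next lemmas confirm that \<open>cf_digit\<close> yields the regular continued fraction expansion:
  \<open>x = 1/(a\<^sub>1 + 1/(a\<^sub>2 + \<dots> + 1/(a\<^sub>n + t)))\<close> with positive integers \<open>a\<^sub>i\<close>
  and \<open>0 < t < 1\<close>, for every \<open>n\<close>.
\<close>

lemma gauss_map_unit_irrationals:
  assumes "x \<in> unit_irrationals"
  shows "gauss_map x \<in> unit_irrationals"
proof -
  have "1 / x \<notin> \<rat>"
  proof
    assume "1 / x \<in> \<rat>"
    then have "inverse (1 / x) \<in> \<rat>" by (rule Rats_inverse)
    with assms show False by (simp add: unit_irrationals_def)
  qed
  moreover have "1 / x = gauss_map x + of_int \<lfloor>1 / x\<rfloor>"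
    by (simp add: gauss_map_def frac_def)
  ultimately have irr: "gauss_map x \<notin> \<rat>"
    by (metis Rats_add Rats_of_int)
  then have "gauss_map x \<noteq> 0" by auto
  with irr show ?thesis
    using frac_ge_0[of "1 / x"] frac_lt_1[of "1 / x"]
    by (simp add: unit_irrationals_def gauss_map_def)
qed

lemma gauss_map_funpow_unit_irrationals:
  "x \<in> unit_irrationals \<Longrightarrow> (gauss_map ^^ n) x \<in> unit_irrationals"
  by (induction n) (simp_all add: gauss_map_unit_irrationals)

lemma cf_digit_pos:
  assumes "x \<in> unit_irrationals"
  shows "cf_digit x n \<ge> 1"
proof -
  have "(gauss_map ^^ (n - 1)) x \<in> unit_irrationals"
    by (rule gauss_map_funpow_unit_irrationals[OF assms])
  then have "1 \<le> 1 / (gauss_map ^^ (n - 1)) x"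
    by (simp add: unit_irrationals_def)
  then show ?thesis
    unfolding cf_digit_def by linarith
qed

lemma gauss_map_step:
  assumes "x \<in> unit_irrationals"
  shows "(gauss_map ^^ n) x = 1 / (real (cf_digit x (Suc n)) + (gauss_map ^^ Suc n) x)"
proof -
  define y where "y = (gauss_map ^^ n) x"
  have "y > 0"
    using gauss_map_funpow_unit_irrationals[OF assms, of n]
    by (simp add: unit_irrationals_def y_def)
  then have "real (nat \<lfloor>1 / y\<rfloor>) + frac (1 / y) = 1 / y"
    by (simp add: frac_def)
  with \<open>y > 0\<close> show ?thesis
    by (simp add: cf_digit_def gauss_map_def flip: y_def)
qed

lemma cf_expansion:
  assumes "x \<in> unit_irrationals"
  shows "x = foldr (\<lambda>a t. 1 / (real a + t)) (map (cf_digit x) [1..<Suc n]) ((gauss_map ^^ n) x)"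
proof (induction n)
  case 0
  then show ?case by simp
next
  case (Suc n)
  let ?F = "\<lambda>m. foldr (\<lambda>a t. 1 / (real a + t)) (map (cf_digit x) [1..<Suc m])"
  have "?F (Suc n) ((gauss_map ^^ Suc n) x)
      = ?F n (1 / (real (cf_digit x (Suc n)) + (gauss_map ^^ Suc n) x))"
    by (simp del: funpow.simps)
  also have "\<dots> = ?F n ((gauss_map ^^ n) x)"
    by (rule arg_cong[OF gauss_map_step[OF assms, of n, symmetric]])
  also have "\<dots> = x"
    by (rule Suc.IH[symmetric])
  finally show ?case by (rule sym)
qed

section \<open>The level sets and their dimension spectrum\<close>

definition level_set :: "real \<Rightarrow> real set" where
  "level_set \<alpha> = {x \<in> unit_irrationals.
     (\<lambda>n. ln (\<Prod>i=1..n. real (cf_digit x i)) / ln (real (cf_denom x n))) \<longlonglongrightarrow> \<alpha>}"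

definition dim_spectrum :: "real \<Rightarrow> ereal" where
  "dim_spectrum \<alpha> = hausdorff_dim (level_set \<alpha>)"

end

theory Submission
  imports Defs "HOL-Probability.Probability_Mass_Function" "HOL-Probability.Infinite_Product_Measure"
    "HOL-Real_Asymp.Real_Asymp" "HOL-Library.Nat_Bijection"
begin

text \<open>
  Write \<open>\<epsilon> = 1 - \<alpha>\<close> and \<open>L = ln (1 / \<epsilon>)\<close>; the claim is that the dimension exceeds \<open>1/2\<close> by
  an amount of order \<open>ln L / L\<close>. The denominator \<open>q\<close> of a word of digits is at least
  the product of the digits, and \<open>\<epsilon>\<close> is the relative size of \<open>ln q - ln (\<Prod>a\<^sub>i)\<close>. Two neighbouring
  digits \<open>a, b\<close> multiply \<open>q\<close> by at least \<open>a b + 1\<close>, so they contribute about \<open>1 / (a b)\<close> to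
  this difference, and for points of the level set most products \<open>a b\<close> have to be at least a power of \<open>1 / \<epsilon>\<close>.
  Digits that are merely large carry dimension \<open>1/2\<close>; the excess comes from the freedom to let
  \<open>ln a\<close> range over an interval of length comparable to \<open>L\<close>, over which \<open>\<Sum>1 / a\<close> is of order \<open>L\<close>.
  Since a cylinder with denominator \<open>q\<close> has length about \<open>q powr (-2)\<close>, the exponent \<open>1/2 + \<eta>\<close> has
  to balance \<open>a powr (-2 * \<eta>)\<close>, which is \<open>exp (- c * \<eta> * L)\<close>, against \<open>1 / L\<close>. This
  gives \<open>\<eta>\<close> of order \<open>ln L / L\<close>.

  For the upper bound, the level set is covered by the cylinders of even length whose digit product
  is at least \<open>q powr (1 - 2 * \<epsilon>)\<close>. A Chebyshev factor \<open>(\<Prod>a\<^sub>i * q powr (2 * \<epsilon> - 1)) powr t\<close> with \<open>t\<close> of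
  size \<open>1 / \<epsilon>\<close> up to logarithms replaces this condition, and the factors \<open>a b + 1\<close> then bound the \<open>s\<close>-th power
  of the diameter by a product of weights of the single digits (\<open>word_weight_le\<close>). As soon as
  these weights sum to at most \<open>1/2\<close>, the long words contribute a geometric tail, and the Hausdorff
  measure vanishes (\<open>dim_spectrum_le\<close>).

  For the lower bound, let the free digits be arbitrary even numbers between roughly
  \<open>1 / \<epsilon>\<close> and \<open>1 / \<epsilon>\<^sup>2\<close>. They alone would make the ratio of logarithms slightly too large. The excess
  \<open>ln (\<Prod>a\<^sub>i) - \<alpha> * ln q\<close> is therefore monitored, and two digits \<open>1\<close> are inserted before a free
  digit whenever it is positive. This feedback keeps the excess bounded, so that \<^emph>\<open>every\<close> choice of
  free digits yields a point of the level set (\<open>steered_point_in_level_set\<close>). The insertions cost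
  only a constant factor in \<open>q\<close> per free digit, which is harmless against the gain of order \<open>L\<close>.
  Choosing the free digits independently at random gives a mass distribution on this Cantor set
  (\<open>dim_spectrum_ge\<close>).
\<close>

section \<open>Continuants and the distance between continued fractions\<close>

text \<open>
  The pair \<open>(q\<^sub>n, q\<^sub>n\<^sub>-\<^sub>1)\<close> of a word of \<open>n\<close> digits. Working with words rather than with points makes
  it possible to sum over all words and to build digit sequences adaptively.
\<close>

definition continuant_pair :: "nat list \<Rightarrow> real \<times> real" where
  "continuant_pair w = fold (\<lambda>a (q, q'). (real a * q + q', q)) w (1, 0)"

abbreviation continuant :: "nat list \<Rightarrow> real" where
  "continuant w \<equiv> fst (continuant_pair w)"

abbreviation continuant_prev :: "nat list \<Rightarrow> real" where
  "continuant_prev w \<equiv> snd (continuant_pair w)"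

definition digits :: "real \<Rightarrow> nat \<Rightarrow> nat list" where
  "digits x n = map (cf_digit x) [1..<Suc n]"

lemma continuant_Nil [simp]: "continuant [] = 1" "continuant_prev [] = 0"
  by (simp_all add: continuant_pair_def)

lemma continuant_snoc [simp]:
  "continuant (w @ [a]) = real a * continuant w + continuant_prev w"
  "continuant_prev (w @ [a]) = continuant w"
  by (simp_all add: continuant_pair_def split_beta)

lemma digits_0 [simp]: "digits x 0 = []"
  by (simp add: digits_def)

lemma digits_Suc: "digits x (Suc n) = digits x n @ [cf_digit x (Suc n)]"
  by (simp add: digits_def)

lemma length_digits [simp]: "length (digits x n) = n"
  by (simp add: digits_def)

lemma cf_denom_eq_continuant: "real (cf_denom x n) = continuant (digits x n)"
proof (induction x n rule: cf_denom.induct)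
  case (2 x)
  show ?case by (simp only: digits_Suc continuant_snoc) simp
next
  case (3 x n)
  have "continuant (digits x (Suc (Suc n)))
      = real (cf_digit x (Suc (Suc n))) * continuant (digits x (Suc n)) + continuant (digits x n)"
    by (simp only: digits_Suc[of x "Suc n"] continuant_snoc) (simp only: digits_Suc continuant_snoc)
  then show ?case using 3 by simp
qed simp

lemma prod_digits: "(\<Prod>i=1..n. real (cf_digit x i)) = real (prod_list (digits x n))"
  by (induction n) (simp_all add: digits_Suc)

abbreviation admissible :: "nat list \<Rightarrow> bool" where
  "admissible w \<equiv> (\<forall>a\<in>set w. 1 \<le> a)"

lemma admissible_digits:
  assumes "x \<in> unit_irrationals" shows "admissible (digits x n)"
  using cf_digit_pos[OF assms] by (auto simp: digits_def)

lemma continuant_bounds: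
  assumes "admissible w"
  shows "1 \<le> continuant w \<and> 0 \<le> continuant_prev w \<and> continuant_prev w \<le> continuant w"
  using assms
proof (induction w rule: rev_induct)
  case (snoc a w)
  then have "1 * continuant w \<le> real a * continuant w" by (intro mult_right_mono) auto
  moreover have "0 \<le> continuant_prev w" "1 \<le> continuant w" using snoc by auto
  ultimately show ?case unfolding continuant_snoc by linarith
qed simp

text \<open>
  The summand \<open>1\<close> is the only difference between denominators and digit products that the upper
  bound exploits. Taking the digits in disjoint pairs makes these gains multiply.
\<close>

lemma continuant_snoc2_ge:
  assumes "admissible (w @ [a, b])"
  shows "(real a * real b + 1) * continuant w \<le> continuant (w @ [a, b])"
proof -
  have "w @ [a, b] = (w @ [a]) @ [b]" by simp
  then have "continuant (w @ [a, b]) = real b * (real a * continuant w + continuant_prev w) + continuant w"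
    by (simp only: continuant_snoc)
  moreover have "0 \<le> real b * continuant_prev w" using continuant_bounds[of w] assms by simp
  ultimately show ?thesis by (simp add: algebra_simps)
qed

lemma even_length_induct [consumes 1, case_names Nil snoc2]:
  assumes "even (length w)" "P []"
    and "\<And>w a b. even (length w) \<Longrightarrow> P w \<Longrightarrow> P (w @ [a, b])"
  shows "P w"
  using assms(1)
proof (induction "length w" arbitrary: w rule: less_induct)
  case less
  show ?case
  proof (cases w rule: rev_cases)
    case Nil
    then show ?thesis using assms(2) by simp
  next
    case (snoc v b)
    then have "v \<noteq> []" using less.prems by auto
    then obtain u a where "v = u @ [a]" by (cases v rule: rev_cases) auto
    then have w: "w = u @ [a, b]" using snoc by simp
    then show ?thesis using less assms(3)[of u a b] by auto
  qed
qed

lemma continuant_ge_power2: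
  assumes "even (length w)" "admissible w"
  shows "2 ^ (length w div 2) \<le> continuant w"
  using assms
proof (induction rule: even_length_induct)
  case (snoc2 w a b)
  have "1 * 1 \<le> real a * real b" using snoc2.prems by (intro mult_mono) auto
  then have "2 * continuant w \<le> (real a * real b + 1) * continuant w"
    using continuant_bounds[of w] snoc2.prems by (intro mult_right_mono) auto
  also have "\<dots> \<le> continuant (w @ [a, b])" by (rule continuant_snoc2_ge) (use snoc2 in auto)
  finally show ?case using snoc2 by auto
qed simp

lemma unit_irrationalsD:
  assumes "x \<in> unit_irrationals" shows "0 < x" "x < 1"
  using assms by (auto simp: unit_irrationals_def)

text \<open>
  The derivative of the \<open>n\<close>-th inverse branch is, up to sign, the square of this orbit product. Expressing it by
  denominators alone avoids the numerators of the convergents.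
\<close>

lemma orbit_product:
  assumes x: "x \<in> unit_irrationals"
  shows "(\<Prod>k<n. (gauss_map ^^ k) x) *
    (continuant (digits x n) + continuant_prev (digits x n) * (gauss_map ^^ n) x) = 1"
proof (induction n)
  case (Suc n)
  define T where "T = (gauss_map ^^ n) x"
  define T' where "T' = (gauss_map ^^ Suc n) x"
  define a where "a = real (cf_digit x (Suc n))"
  have pos: "0 < T'" using unit_irrationalsD(1)[OF gauss_map_funpow_unit_irrationals[OF x, of "Suc n"]]
    by (simp add: T'_def)
  have step: "T = 1 / (a + T')" unfolding T_def T'_def a_def by (rule gauss_map_step[OF x])
  have "0 < a + T'" using pos by (simp add: a_def add_nonneg_pos)
  then have "T * (continuant (digits x (Suc n)) + continuant_prev (digits x (Suc n)) * T')
      = continuant (digits x n) + continuant_prev (digits x n) * T"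
    unfolding step digits_Suc continuant_snoc a_def[symmetric] by (simp add: field_simps)
  with Suc show ?case
    by (simp add: T_def[symmetric] T'_def[symmetric] mult.assoc del: funpow.simps)
qed simp

lemma orbit_product_bounds:
  assumes x: "x \<in> unit_irrationals"
  shows "(\<Prod>k<n. (gauss_map ^^ k) x) \<le> 1 / continuant (digits x n)"
    and "1 / (2 * continuant (digits x n)) \<le> (\<Prod>k<n. (gauss_map ^^ k) x)"
proof -
  define q q' T where "q = continuant (digits x n)" and "q' = continuant_prev (digits x n)"
    and "T = (gauss_map ^^ n) x"
  have q: "1 \<le> q" "0 \<le> q'" "q' \<le> q"
    using continuant_bounds[OF admissible_digits[OF x, of n]] by (auto simp: q_def q'_def)
  have T: "0 < T" "T < 1"
    using unit_irrationalsD[OF gauss_map_funpow_unit_irrationals[OF x, of n]] by (auto simp: T_def)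
  have "q' * T \<le> q * 1" using q T by (intro mult_mono) auto
  moreover have "0 \<le> q' * T" using q T by simp
  moreover have "(\<Prod>k<n. (gauss_map ^^ k) x) = 1 / (q + q' * T)"
    using orbit_product[OF x, of n] q calculation
    by (simp add: q_def q'_def T_def field_simps)
  ultimately show "(\<Prod>k<n. (gauss_map ^^ k) x) \<le> 1 / continuant (digits x n)"
    and "1 / (2 * continuant (digits x n)) \<le> (\<Prod>k<n. (gauss_map ^^ k) x)"
    using q by (auto simp: q_def[symmetric] intro!: divide_left_mono)
qed

lemma digits_eqD: "digits x n = digits y n \<Longrightarrow> k < n \<Longrightarrow> cf_digit x (Suc k) = cf_digit y (Suc k)"
  by (simp add: digits_def del: upt_Suc)

lemma digits_eq_pred: "digits x (Suc n) = digits y (Suc n) \<Longrightarrow> digits x n = digits y n"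
  by (simp add: digits_Suc)

text \<open>
  An exact chain rule: one inverse branch multiplies the distance of \<open>s\<close> and \<open>t\<close> by the
  product of the image points, since \<open>1 / (a + s) - 1 / (a + t) = (t - s) / ((a + s) * (a + t))\<close>.
\<close>

lemma cylinder_distance:
  assumes x: "x \<in> unit_irrationals" and y: "y \<in> unit_irrationals" and "digits x n = digits y n"
  shows "\<bar>x - y\<bar> = \<bar>(gauss_map ^^ n) x - (gauss_map ^^ n) y\<bar> *
    ((\<Prod>k<n. (gauss_map ^^ k) x) * (\<Prod>k<n. (gauss_map ^^ k) y))"
  using assms(3)
proof (induction n)
  case (Suc n)
  define s t a where "s = (gauss_map ^^ Suc n) x" and "t = (gauss_map ^^ Suc n) y"
    and "a = real (cf_digit x (Suc n))"
  have pos: "0 < s" "0 < t"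
    using unit_irrationalsD(1)[OF gauss_map_funpow_unit_irrationals[OF x, of "Suc n"]]
      unit_irrationalsD(1)[OF gauss_map_funpow_unit_irrationals[OF y, of "Suc n"]]
    by (auto simp: s_def t_def)
  have sx: "(gauss_map ^^ n) x = 1 / (a + s)" unfolding s_def a_def by (rule gauss_map_step[OF x])
  have ty: "(gauss_map ^^ n) y = 1 / (a + t)"
    using gauss_map_step[OF y, of n] digits_eqD[OF Suc.prems, of n] by (simp add: t_def a_def)
  have a: "0 \<le> a" by (simp add: a_def)
  have "1 / (a + s) - 1 / (a + t) = (t - s) * (1 / (a + s) * (1 / (a + t)))"
    using pos a by (simp add: field_simps)
  then have "\<bar>1 / (a + s) - 1 / (a + t)\<bar> = \<bar>s - t\<bar> * (1 / (a + s) * (1 / (a + t)))"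
    using pos a by (simp add: abs_mult)
  then show ?case
    using Suc.IH[OF digits_eq_pred[OF Suc.prems]]
    by (simp add: s_def[symmetric] t_def[symmetric] sx ty mult_ac del: funpow.simps)
qed simp

lemma cylinder_distance_bounds:
  assumes x: "x \<in> unit_irrationals" and y: "y \<in> unit_irrationals" and eq: "digits x n = digits y n"
  shows "\<bar>x - y\<bar> \<le> continuant (digits x n) powr (-2)"
    and "\<bar>(gauss_map ^^ n) x - (gauss_map ^^ n) y\<bar> / 4 * continuant (digits x n) powr (-2) \<le> \<bar>x - y\<bar>"
proof -
  define q where "q = continuant (digits x n)"
  define D where "D = \<bar>(gauss_map ^^ n) x - (gauss_map ^^ n) y\<bar>"
  have q: "1 \<le> q"
    using continuant_bounds[OF admissible_digits[OF x, of n]] by (auto simp: q_def)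
  have D: "0 \<le> D" "D \<le> 1"
    using unit_irrationalsD[OF gauss_map_funpow_unit_irrationals[OF x, of n]]
      unit_irrationalsD[OF gauss_map_funpow_unit_irrationals[OF y, of n]] by (auto simp: D_def)
  define u v where "u = (\<Prod>k<n. (gauss_map ^^ k) x)" and "v = (\<Prod>k<n. (gauss_map ^^ k) y)"
  have uv: "u \<le> 1 / q" "1 / (2 * q) \<le> u" "v \<le> 1 / q" "1 / (2 * q) \<le> v"
    using orbit_product_bounds[OF x, of n] orbit_product_bounds[OF y, of n] eq
    by (auto simp: u_def v_def q_def)
  have uv0: "0 \<le> u" "0 \<le> v" using uv(2,4) q by (auto intro: order_trans[rotated])
  have qq: "q powr (-2) = 1 / q * (1 / q)"
    using q by (simp add: powr_minus powr_numeral divide_inverse power2_eq_square)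
  have dist: "\<bar>x - y\<bar> = D * (u * v)"
    unfolding D_def u_def v_def by (rule cylinder_distance[OF x y eq])
  have "D * (u * v) \<le> 1 * (1 / q * (1 / q))"
    using uv uv0 D q by (intro mult_mono) auto
  then show "\<bar>x - y\<bar> \<le> continuant (digits x n) powr (-2)"
    by (simp only: dist qq q_def[symmetric] mult_1)
  have "1 / (2 * q) * (1 / (2 * q)) \<le> u * v"
    using uv uv0 q by (intro mult_mono) auto
  then have "D * (1 / (2 * q) * (1 / (2 * q))) \<le> D * (u * v)"
    using D by (intro mult_left_mono) auto
  then show "\<bar>(gauss_map ^^ n) x - (gauss_map ^^ n) y\<bar> / 4 * continuant (digits x n) powr (-2) \<le> \<bar>x - y\<bar>"
    by (simp add: dist qq q_def[symmetric] D_def[symmetric])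
qed

lemma continuant_digits_at_top:
  assumes x: "x \<in> unit_irrationals"
  shows "filterlim (\<lambda>n. continuant (digits x n)) at_top sequentially"
proof (rule filterlim_at_top_mono)
  show "filterlim (\<lambda>n::nat. 2 powr ((real n - 1) / 2)) at_top sequentially"
    by real_asymp
  show "\<forall>\<^sub>F n in sequentially. 2 powr ((real n - 1) / 2) \<le> continuant (digits x n)"
  proof (rule always_eventually, rule allI)
    fix n :: nat
    define m where "m = n div 2"
    have n: "n = 2 * m \<or> n = Suc (2 * m)" unfolding m_def by linarith
    have adm: "admissible (digits x k)" for k by (rule admissible_digits[OF x])
    have 1: "2 ^ m \<le> continuant (digits x (2 * m))"
      using continuant_ge_power2[of "digits x (2 * m)"] adm by simp
    have "1 * continuant (digits x (2 * m)) \<le> real (cf_digit x (Suc (2 * m))) * continuant (digits x (2 * m))"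
      using cf_digit_pos[OF x, of "Suc (2 * m)"] continuant_bounds[OF adm, of "2 * m"]
      by (intro mult_right_mono) auto
    then have "continuant (digits x (2 * m)) \<le> continuant (digits x (Suc (2 * m)))"
      using continuant_bounds[OF adm, of "2 * m"] unfolding digits_Suc continuant_snoc by linarith
    then have 2: "2 ^ m \<le> continuant (digits x n)" using 1 n by auto
    have "2 powr ((real n - 1) / 2) \<le> 2 powr real m" using n by (intro powr_mono) auto
    also have "\<dots> = 2 ^ m" by (simp add: powr_realpow)
    finally show "2 powr ((real n - 1) / 2) \<le> continuant (digits x n)" using 2 by simp
  qed
qed

lemma level_set_iff:
  "x \<in> level_set \<alpha> \<longleftrightarrow> x \<in> unit_irrationals \<and>
    (\<lambda>n. ln (real (prod_list (digits x n))) / ln (continuant (digits x n))) \<longlonglongrightarrow> \<alpha>"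
  unfolding level_set_def prod_digits cf_denom_eq_continuant by simp

section \<open>Upper bound for the dimension\<close>

lemma sum_over_words:
  fixes g :: "'a \<Rightarrow> real"
  assumes "finite A"
  shows "(\<Sum>w\<in>{w. set w \<subseteq> A \<and> length w = n}. prod_list (map g w)) = (\<Sum>a\<in>A. g a) ^ n"
proof (induction n)
  case 0
  have "{w. set w \<subseteq> A \<and> length w = 0} = {[]}" by auto
  then show ?case by simp
next
  case (Suc n)
  let ?W = "\<lambda>n. {w. set w \<subseteq> A \<and> length w = n}"
  have inj: "inj_on (\<lambda>(a, w). a # w) (A \<times> ?W n)" by (auto simp: inj_on_def)
  have "?W (Suc n) = (\<lambda>(a, w). a # w) ` (A \<times> ?W n)"
    by (auto simp: length_Suc_conv image_iff)
  then have "(\<Sum>w\<in>?W (Suc n). prod_list (map g w)) = (\<Sum>(a, w)\<in>A \<times> ?W n. g a * prod_list (map g w))"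
    by (simp only:) (subst sum.reindex[OF inj], simp add: split_beta)
  also have "\<dots> = (\<Sum>a\<in>A. g a) * (\<Sum>w\<in>?W n. prod_list (map g w))"
    by (simp add: sum_product sum.cartesian_product)
  finally show ?case using Suc by simp
qed

text \<open>
  Comparison with the integral of \<open>x powr (-1 - d)\<close>: each summand is at most the
  corresponding difference of the antiderivative \<open>- x powr (-d) / d\<close>.
\<close>

lemma powr_sum_le:
  fixes d :: real
  assumes d: "0 < d"
  shows "(\<Sum>a=1..K. real a powr (-1 - d)) \<le> 1 + 1 / d"
proof -
  have "(\<Sum>a=1..Suc K. real a powr (-1 - d)) \<le> 1 + 1 / d - real (Suc K) powr (-d) / d" for K
  proof (induction K)
    case (Suc K)
    define x y where "x = real (Suc K)" and "y = real (Suc (Suc K))"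
    have xy: "0 < x" "y = x + 1" by (auto simp: x_def y_def)
    have "ln (x / y) \<le> x / y - 1" using xy by (intro ln_le_minus_one) auto
    then have "1 / y \<le> ln y - ln x" using xy by (simp add: ln_div field_simps)
    then have "d * (1 / y) \<le> d * (ln y - ln x)" using d by (intro mult_left_mono) auto
    then have "d / y \<le> d * (ln y - ln x)" by simp
    then have "1 + d / y \<le> exp (d * (ln y - ln x))"
      using exp_ge_add_one_self[of "d * (ln y - ln x)"] by linarith
    also have "\<dots> = x powr (-d) / y powr (-d)"
      using xy by (simp add: powr_def exp_diff[symmetric] algebra_simps)
    finally have "(1 + d / y) * y powr (-d) \<le> x powr (-d)"
      using xy by (simp add: pos_le_divide_eq)
    moreover have "y powr (-1 - d) = y powr (-d) / y"
      using xy powr_diff[of y "-d" 1] by (simp only: minus_diff_commute) (simp add: powr_one)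
    ultimately have "d * y powr (-1 - d) \<le> x powr (-d) - y powr (-d)"
      by (simp add: algebra_simps)
    then have "y powr (-1 - d) \<le> x powr (-d) / d - y powr (-d) / d"
      using d by (simp add: field_simps)
    then show ?case using Suc by (simp add: x_def y_def)
  qed simp
  note * = this
  show ?thesis
  proof (cases K)
    case (Suc k)
    show ?thesis using order_trans[OF *[of k], of "1 + 1 / d"] d Suc by simp
  qed (use d in auto)
qed

text \<open>
  Here \<open>m\<close> is the product of two neighbouring digits. The factor \<open>(1 + 1 / m) powr t\<close> is at least
  both \<open>1\<close> and \<open>u = t / (2 * m)\<close>, hence at least \<open>u powr (h / 2)\<close>. Half of the exponent
  \<open>h\<close> is thus traded for a power of \<open>t\<close>, and the other half keeps the sum over \<open>m\<close> convergent.
\<close>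

lemma pair_weight_le:
  fixes t h m :: real
  assumes t: "2 \<le> t" and h: "0 \<le> h" "h \<le> 2" and m: "1 \<le> m"
  shows "m powr t * (m + 1) powr (-(t + 1 + h)) \<le> (t / 2) powr (-(h / 2)) * m powr (-1 - h / 2)"
proof -
  define u where "u = (t / 2) / m"
  have "ln (m / (m + 1)) \<le> m / (m + 1) - 1" using m by (intro ln_le_minus_one) auto
  then have l: "1 / (m + 1) \<le> ln (m + 1) - ln m" using m by (simp add: ln_div field_simps)
  have "u \<le> t * (1 / (m + 1))"
    using t m by (simp add: u_def field_simps)
  also have "\<dots> \<le> t * (ln (m + 1) - ln m)" using t l by (intro mult_left_mono) auto
  finally have "u \<le> exp (t * (ln (m + 1) - ln m))"
    using exp_ge_add_one_self[of "t * (ln (m + 1) - ln m)"] by linarith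
  moreover have "1 \<le> exp (t * (ln (m + 1) - ln m))" using t m by simp
  moreover have "u powr (h / 2) \<le> max 1 u"
  proof (cases "u \<le> 1")
    case True
    have "0 \<le> u" using t m by (simp add: u_def)
    then show ?thesis using True h powr_le1[of "h/2" u] by simp
  next
    case False
    then have "u powr (h / 2) \<le> u powr 1" using h by (intro powr_mono) auto
    then show ?thesis using False by simp
  qed
  ultimately have "u powr (h / 2) \<le> exp (t * (ln (m + 1) - ln m))" by linarith
  also have "\<dots> = (m + 1) powr t * m powr (-t)"
  proof -
    have "t * (ln (m + 1) - ln m) = t * ln (m + 1) + (- t) * ln m" by (simp add: algebra_simps)
    then show ?thesis using m by (simp only: exp_add) (simp add: powr_def)
  qed
  finally have 1: "u powr (h / 2) \<le> (m + 1) powr t * m powr (-t)" .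
  have up: "u powr (h / 2) = (t / 2) powr (h / 2) * m powr (-(h / 2))"
    using t m unfolding u_def powr_minus_divide by (subst powr_divide) auto
  have "m powr t * (m + 1) powr (-(t + 1 + h)) * u powr (h / 2)
      \<le> m powr t * (m + 1) powr (-(t + 1 + h)) * ((m + 1) powr t * m powr (-t))"
    by (rule mult_left_mono[OF 1]) auto
  also have "\<dots> = (m + 1) powr (-(1 + h))"
  proof -
    have "m powr t * m powr (-t) = 1" using m by (simp add: powr_add[symmetric])
    moreover have "(m + 1) powr (-(t + 1 + h)) * (m + 1) powr t = (m + 1) powr (-(1 + h))"
      using m by (simp add: powr_add[symmetric])
    moreover have "m powr t * (m + 1) powr (-(t + 1 + h)) * ((m + 1) powr t * m powr (-t))
        = (m powr t * m powr (-t)) * ((m + 1) powr (-(t + 1 + h)) * (m + 1) powr t)"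
      by (simp only: mult_ac)
    ultimately show ?thesis by (simp only: mult_1)
  qed
  also have "\<dots> \<le> m powr (-(1 + h))" using m h by (intro powr_mono2') auto
  also have "\<dots> = ((t / 2) powr (-(h / 2)) * m powr (-1 - h / 2)) * u powr (h / 2)"
  proof -
    have "(t / 2) powr (-(h / 2)) * (t / 2) powr (h / 2) = 1" using t by (simp add: powr_add[symmetric])
    moreover have "m powr (-1 - h / 2) * m powr (-(h / 2)) = m powr (-(1 + h))"
    proof -
      have "-1 - h / 2 + -(h / 2) = -(1 + h)" by simp
      then show ?thesis by (simp only: powr_add[symmetric])
    qed
    moreover have "((t / 2) powr (-(h / 2)) * m powr (-1 - h / 2)) * ((t / 2) powr (h / 2) * m powr (-(h / 2)))
        = ((t / 2) powr (-(h / 2)) * (t / 2) powr (h / 2)) * (m powr (-1 - h / 2) * m powr (-(h / 2)))"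
      by (simp only: mult_ac)
    ultimately show ?thesis unfolding up by (simp only: mult_1)
  qed
  finally show ?thesis
    using up t m by (simp add: mult_le_cancel_right)
qed

text \<open>
  The square root of the constant in \<open>pair_weight_le\<close> goes to each digit of the pair, so that the
  sum over words becomes a power of a sum over single digits.
\<close>

definition digit_weight :: "real \<Rightarrow> real \<Rightarrow> nat \<Rightarrow> real" where
  "digit_weight t h a = (t / 2) powr (-(h / 4)) * real a powr (-1 - h / 2)"

lemma word_weight_le:
  assumes t: "2 \<le> t" and h: "0 \<le> h" "h \<le> 2"
    and "even (length w)" "admissible w"
  shows "real (prod_list w) powr t * continuant w powr (-(t + 1 + h))
    \<le> prod_list (map (digit_weight t h) w)"
  using assms(4,5)
proof (induction rule: even_length_induct)
  case (snoc2 w a b)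
  define m where "m = real a * real b"
  have adm: "admissible w" using snoc2.prems by auto
  have "1 * 1 \<le> real a * real b" using snoc2.prems by (intro mult_mono) auto
  then have m: "1 \<le> m" by (simp add: m_def)
  have q: "1 \<le> continuant w" using continuant_bounds[OF adm] by simp
  have "continuant (w @ [a, b]) powr (-(t + 1 + h)) \<le> ((m + 1) * continuant w) powr (-(t + 1 + h))"
    using continuant_snoc2_ge[OF snoc2.prems] t h m q by (intro powr_mono2') (auto simp: m_def)
  also have "\<dots> = (m + 1) powr (-(t + 1 + h)) * continuant w powr (-(t + 1 + h))"
    using m q by (simp add: powr_mult)
  finally have 1: "continuant (w @ [a, b]) powr (-(t + 1 + h))
      \<le> (m + 1) powr (-(t + 1 + h)) * continuant w powr (-(t + 1 + h))" .
  have "real (prod_list (w @ [a, b])) powr t = real (prod_list w) powr t * m powr t"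
    by (simp add: m_def powr_mult[symmetric] mult_ac)
  then have "real (prod_list (w @ [a, b])) powr t * continuant (w @ [a, b]) powr (-(t + 1 + h))
    \<le> (real (prod_list w) powr t * m powr t) * ((m + 1) powr (-(t + 1 + h)) * continuant w powr (-(t + 1 + h)))"
    using mult_left_mono[OF 1, of "real (prod_list w) powr t * m powr t"] by simp
  also have "\<dots> = (real (prod_list w) powr t * continuant w powr (-(t + 1 + h))) * (m powr t * (m + 1) powr (-(t + 1 + h)))"
    by (simp only: mult_ac)
  also have "\<dots> \<le> prod_list (map (digit_weight t h) w) *
      ((t / 2) powr (-(h / 2)) * m powr (-1 - h / 2))"
    by (intro mult_mono snoc2.IH adm pair_weight_le t h m prod_list_nonneg)
      (auto simp: digit_weight_def)
  also have "(t / 2) powr (-(h / 2)) * m powr (-1 - h / 2) = digit_weight t h a * digit_weight t h b"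
  proof -
    have "(t / 2) powr (-(h / 2)) = (t / 2) powr (-(h / 4)) * (t / 2) powr (-(h / 4))"
      by (simp add: powr_add[symmetric])
    then show ?thesis by (simp add: digit_weight_def m_def powr_mult mult_ac)
  qed
  finally show ?case by simp
qed simp

lemma digit_weight_sum_le:
  assumes "0 < h"
  shows "(\<Sum>a=1..K. digit_weight t h a) \<le> (t / 2) powr (-(h / 4)) * (1 + 2 / h)"
  unfolding digit_weight_def sum_distrib_left[symmetric]
  using powr_sum_le[of "h / 2" K] assms by (intro mult_left_mono) auto

lemma hausdorff_measure_eq_0I:
  assumes "\<And>\<delta> e. 0 < \<delta> \<Longrightarrow> 0 < e \<Longrightarrow> \<exists>U\<in>delta_covers \<delta> A. (\<Sum>i. diam_power s (U i)) \<le> ennreal e"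
  shows "hausdorff_measure s A = 0"
proof -
  have "hausdorff_premeasure s \<delta> A \<le> 0" if "0 < \<delta>" for \<delta>
  proof (rule ennreal_le_epsilon)
    fix e :: real assume "0 < e"
    then obtain U where "U \<in> delta_covers \<delta> A" "(\<Sum>i. diam_power s (U i)) \<le> ennreal e"
      using assms[OF \<open>0 < \<delta>\<close>] by blast
    then show "hausdorff_premeasure s \<delta> A \<le> 0 + ennreal e"
      unfolding hausdorff_premeasure_def by (auto intro: INF_lower2)
  qed
  then have "hausdorff_measure s A \<le> 0"
    unfolding hausdorff_measure_def by (intro SUP_least) auto
  then show ?thesis by simp
qed

lemma hausdorff_dim_le:
  assumes "0 \<le> s" "hausdorff_measure s A = 0" shows "hausdorff_dim A \<le> ereal s"
  unfolding hausdorff_dim_def using assms by (intro INF_lower) auto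

text \<open>
  For \<open>\<gamma> < \<alpha>\<close>, every point of the level set lies in the heavy cylinders of all its long prefixes.
\<close>

definition heavy_cylinder :: "real \<Rightarrow> nat list \<Rightarrow> real set" where
  "heavy_cylinder \<gamma> w = {x \<in> unit_irrationals. digits x (length w) = w \<and>
     continuant w powr \<gamma> \<le> real (prod_list w)}"

lemma heavy_cylinder_diameter:
  assumes "admissible w"
  shows "bounded (heavy_cylinder \<gamma> w)" "diameter (heavy_cylinder \<gamma> w) \<le> continuant w powr (-2)"
proof -
  have "heavy_cylinder \<gamma> w \<subseteq> cball 0 1"
    by (auto simp: heavy_cylinder_def unit_irrationals_def)
  then show "bounded (heavy_cylinder \<gamma> w)" using bounded_cball bounded_subset by blast
  show "diameter (heavy_cylinder \<gamma> w) \<le> continuant w powr (-2)"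
  proof (rule diameter_le)
    fix x y assume "x \<in> heavy_cylinder \<gamma> w" "y \<in> heavy_cylinder \<gamma> w"
    then show "norm (x - y) \<le> continuant w powr (-2)"
      using cylinder_distance_bounds(1)[of x y "length w"] by (auto simp: heavy_cylinder_def)
  qed simp
qed

text \<open>
  Chebyshev's trick: on a nonempty heavy cylinder \<open>1 \<le> (prod_list w * continuant w powr (-\<gamma>)) powr t\<close>,
  and the relation between \<open>s\<close>, \<open>t\<close>, \<open>\<gamma>\<close> and \<open>h\<close> turns \<open>continuant w powr (-2 * s)\<close> times this
  factor into the quantity of \<open>word_weight_le\<close>.
\<close>

lemma heavy_cylinder_diam_power:
  assumes t: "2 \<le> t" and h: "0 \<le> h" "h \<le> 2" and s: "2 * s + t * \<gamma> = t + 1 + h" "0 < s"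
    and w: "even (length w)" "admissible w"
  shows "diam_power s (heavy_cylinder \<gamma> w) \<le> ennreal (prod_list (map (digit_weight t h) w))"
proof (cases "heavy_cylinder \<gamma> w = {}")
  case False
  then have heavy: "continuant w powr \<gamma> \<le> real (prod_list w)" by (auto simp: heavy_cylinder_def)
  have q: "1 \<le> continuant w" using continuant_bounds[OF w(2)] by simp
  have "diameter (heavy_cylinder \<gamma> w) powr s \<le> (continuant w powr (-2)) powr s"
    using heavy_cylinder_diameter[OF w(2), of \<gamma>] s by (intro powr_mono2 diameter_ge_0) auto
  also have "\<dots> = (continuant w powr \<gamma>) powr t * continuant w powr (-(t + 1 + h))"
  proof -
    have "- (2 * s) = \<gamma> * t - (t + 1 + h)" using s by (simp add: algebra_simps)
    then show ?thesis using q by (simp add: powr_powr powr_add[symmetric] algebra_simps)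
  qed
  also have "\<dots> \<le> real (prod_list w) powr t * continuant w powr (-(t + 1 + h))"
    using heavy t by (intro mult_right_mono powr_mono2) auto
  also have "\<dots> \<le> prod_list (map (digit_weight t h) w)" by (rule word_weight_le[OF t h w])
  finally show ?thesis using False s by (simp add: diam_power_def ennreal_leI)
qed (simp add: diam_power_def)

lemma level_set_eventually_heavy:
  assumes x: "x \<in> level_set \<alpha>" and "\<gamma> < \<alpha>"
  shows "\<forall>\<^sub>F n in sequentially. x \<in> heavy_cylinder \<gamma> (digits x n)"
proof -
  have xu: "x \<in> unit_irrationals"
    and lim: "(\<lambda>n. ln (real (prod_list (digits x n))) / ln (continuant (digits x n))) \<longlonglongrightarrow> \<alpha>"
    using x by (auto simp: level_set_iff)
  have "\<forall>\<^sub>F n in sequentially. \<gamma> < ln (real (prod_list (digits x n))) / ln (continuant (digits x n))"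
    using order_tendstoD(1)[OF lim \<open>\<gamma> < \<alpha>\<close>] .
  moreover have "\<forall>\<^sub>F n in sequentially. 2 \<le> continuant (digits x n)"
    using continuant_digits_at_top[OF xu] by (simp add: filterlim_at_top)
  ultimately show ?thesis
  proof eventually_elim
    case (elim n)
    have "0 < real (prod_list (digits x n))"
      using admissible_digits[OF xu, of n]
      by (auto simp: prod_list_zero_iff intro!: gr0I)
    moreover have "\<gamma> * ln (continuant (digits x n)) < ln (real (prod_list (digits x n)))"
      using elim by (simp add: pos_less_divide_eq)
    moreover have "continuant (digits x n) powr \<gamma> = exp (\<gamma> * ln (continuant (digits x n)))"
      using elim by (simp add: powr_def)
    ultimately have "continuant (digits x n) powr \<gamma> \<le> real (prod_list (digits x n))"
      using exp_le_cancel_iff[of "\<gamma> * ln (continuant (digits x n))" "ln (real (prod_list (digits x n)))"]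
      by simp
    then show ?case using xu by (simp add: heavy_cylinder_def)
  qed
qed

text \<open>
  The words of length \<open>n\<close> contribute the \<open>n\<close>-th power of the sum of the weights, so this is
  a geometric tail.
\<close>

lemma sum_of_long_words_le:
  fixes g :: "nat \<Rightarrow> real"
  assumes g: "\<And>a. 0 \<le> g a" and r: "\<And>K. (\<Sum>a=1..K. g a) \<le> 1 / 2"
    and F: "finite F" "\<And>w. w \<in> F \<Longrightarrow> admissible w \<and> m \<le> length w"
  shows "(\<Sum>w\<in>F. prod_list (map g w)) \<le> 2 * (1 / 2) ^ m"
proof -
  obtain K where K: "\<And>w. w \<in> F \<Longrightarrow> set w \<subseteq> {..K}"
  proof -
    have "finite (\<Union>w\<in>F. set w)" using F by auto
    then obtain K where "(\<Union>w\<in>F. set w) \<subseteq> {..K}" using finite_nat_iff_bounded_le by auto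
    then show ?thesis using that[of K] by auto
  qed
  obtain N where N: "length ` F \<subseteq> {..N}" using F finite_nat_iff_bounded_le[of "length ` F"] by auto
  let ?W = "\<lambda>n. {w. set w \<subseteq> {1..K} \<and> length w = n}"
  have sub: "F \<subseteq> (\<Union>n\<in>{m..N}. ?W n)"
  proof
    fix w assume "w \<in> F"
    then have "set w \<subseteq> {1..K}" "length w \<in> {m..N}" using F(2)[of w] K[of w] N by auto
    then show "w \<in> (\<Union>n\<in>{m..N}. ?W n)" by blast
  qed
  have "(\<Sum>w\<in>F. prod_list (map g w)) \<le> (\<Sum>w\<in>(\<Union>n\<in>{m..N}. ?W n). prod_list (map g w))"
    using sub g by (intro sum_mono2) (auto intro!: finite_lists_length_eq prod_list_nonneg)
  also have "\<dots> = (\<Sum>n=m..N. (\<Sum>w\<in>?W n. prod_list (map g w)))"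
    by (intro sum.UNION_disjoint) (auto intro!: finite_lists_length_eq)
  also have "\<dots> = (\<Sum>n=m..N. (\<Sum>a=1..K. g a) ^ n)" by (simp add: sum_over_words)
  also have "\<dots> \<le> (\<Sum>n=m..N. (1 / 2) ^ n)"
    using r g by (intro sum_mono power_mono sum_nonneg) auto
  also have "\<dots> \<le> 2 * (1 / 2) ^ m"
  proof (cases "m \<le> N")
    case True
    have "(\<Sum>n=m..N. (1 / 2 :: real) ^ n) = ((1 / 2) ^ m - (1 / 2) ^ Suc N) / (1 - 1 / 2)"
      using True by (subst sum_gp) auto
    also have "\<dots> = 2 * (1 / 2) ^ m - 2 * (1 / 2) ^ Suc N"
      by (simp only: diff_divide_distrib) simp
    also have "\<dots> \<le> 2 * (1 / 2) ^ m" by simp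
    finally show ?thesis .
  qed simp
  finally show ?thesis .
qed

text \<open>
  The words are enumerated by \<open>list_decode\<close>; those that are short, of odd length or contain the
  digit \<open>0\<close> are assigned the empty set, which costs nothing.
\<close>

lemma dim_spectrum_le:
  assumes t: "2 \<le> t" and h: "0 < h" "h \<le> 2" and s: "2 * s + t * \<gamma> = t + 1 + h" "0 < s"
    and \<gamma>: "\<gamma> < \<alpha>" and small: "(t / 2) powr (-(h / 4)) * (1 + 2 / h) \<le> 1 / 2"
  shows "dim_spectrum \<alpha> \<le> ereal s"
  unfolding dim_spectrum_def
proof (rule hausdorff_dim_le)
  show "hausdorff_measure s (level_set \<alpha>) = 0"
  proof (rule hausdorff_measure_eq_0I)
    fix \<delta> e :: real assume "0 < \<delta>" "0 < e"
    have "\<forall>\<^sub>F m in sequentially. (2 ^ m) powr (-2) \<le> \<delta>" "\<forall>\<^sub>F m in sequentially. 2 * (1 / 2) ^ (2 * m) \<le> e"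
      using \<open>0 < \<delta>\<close> \<open>0 < e\<close> by real_asymp+
    then have "\<forall>\<^sub>F m in sequentially. (2 ^ m) powr (-2) \<le> \<delta> \<and> 2 * (1 / 2) ^ (2 * m) \<le> e"
      by eventually_elim simp
    then obtain M :: nat where M: "(2 ^ M) powr (-2) \<le> \<delta>" "2 * (1 / 2) ^ (2 * M) \<le> e"
      by (auto simp: eventually_sequentially)
    define good where "good w \<longleftrightarrow> admissible w \<and> even (length w) \<and> 2 * M \<le> length w" for w
    define U where "U i = (if good (list_decode i) then heavy_cylinder \<gamma> (list_decode i) else {})" for i
    have "U \<in> delta_covers \<delta> (level_set \<alpha>)"
      unfolding delta_covers_def
    proof (intro CollectI conjI allI subsetI)
      fix x assume x: "x \<in> level_set \<alpha>"
      then have xu: "x \<in> unit_irrationals" by (simp add: level_set_iff)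
      obtain N where N: "\<And>n. N \<le> n \<Longrightarrow> x \<in> heavy_cylinder \<gamma> (digits x n)"
        using level_set_eventually_heavy[OF x \<gamma>] by (auto simp: eventually_sequentially)
      define w where "w = digits x (2 * (N + M))"
      have "good w" unfolding good_def w_def using admissible_digits[OF xu] by simp
      then have "x \<in> U (list_encode w)"
        unfolding U_def using N[of "2 * (N + M)"] by (simp add: w_def)
      then show "x \<in> (\<Union>i. U i)" by blast
    next
      fix i
      show "bounded (U i)" using heavy_cylinder_diameter(1) by (auto simp: U_def good_def)
      show "diameter (U i) \<le> \<delta>"
      proof (cases "good (list_decode i)")
        case True
        define w where "w = list_decode i"
        have w: "admissible w" "even (length w)" "M \<le> length w div 2"
          using True by (auto simp: good_def w_def)
        have "(2::real) ^ M \<le> 2 ^ (length w div 2)" using w by (intro power_increasing) auto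
        also have "\<dots> \<le> continuant w" by (rule continuant_ge_power2[OF w(2,1)])
        finally have "continuant w powr (-2) \<le> (2 ^ M) powr (-2)" by (intro powr_mono2') auto
        then show ?thesis
          using heavy_cylinder_diameter(2)[OF w(1), of \<gamma>] M True by (simp add: U_def w_def)
      qed (use \<open>0 < \<delta>\<close> in \<open>simp add: U_def\<close>)
    qed
    moreover have "(\<Sum>i. diam_power s (U i)) \<le> ennreal e"
    proof (rule suminf_le_const)
      fix n
      define I where "I = {i. i < n \<and> good (list_decode i)}"
      have "(\<Sum>i<n. diam_power s (U i)) = (\<Sum>i\<in>I. diam_power s (U i))"
        by (rule sum.mono_neutral_right) (auto simp: I_def U_def diam_power_def)
      also have "\<dots> \<le> (\<Sum>i\<in>I. ennreal (prod_list (map (digit_weight t h) (list_decode i))))"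
      proof (rule sum_mono)
        fix i assume "i \<in> I"
        then show "diam_power s (U i) \<le> ennreal (prod_list (map (digit_weight t h) (list_decode i)))"
          using heavy_cylinder_diam_power[OF t _ h(2) s, of "list_decode i"] h
          by (auto simp: I_def U_def good_def)
      qed
      also have "\<dots> = ennreal (\<Sum>i\<in>I. prod_list (map (digit_weight t h) (list_decode i)))"
        by (intro sum_ennreal prod_list_nonneg) (auto simp: digit_weight_def)
      also have "(\<Sum>i\<in>I. prod_list (map (digit_weight t h) (list_decode i)))
          = (\<Sum>w\<in>list_decode ` I. prod_list (map (digit_weight t h) w))"
        by (subst sum.reindex) (auto intro: inj_on_subset[OF inj_list_decode])
      also have "\<dots> \<le> 2 * (1 / 2) ^ (2 * M)"
      proof (rule sum_of_long_words_le)
        show "(\<Sum>a=1..K. digit_weight t h a) \<le> 1 / 2" for K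
          using digit_weight_sum_le[OF h(1), of t K] small by linarith
      qed (auto simp: I_def good_def digit_weight_def)
      finally show "(\<Sum>i<n. diam_power s (U i)) \<le> ennreal e"
        using M by (auto intro: ennreal_leI order_trans)
    qed simp
    ultimately show "\<exists>U\<in>delta_covers \<delta> (level_set \<alpha>). (\<Sum>i. diam_power s (U i)) \<le> ennreal e" by blast
  qed
qed (use s in simp)

section \<open>Continued fractions with prescribed digits\<close>

text \<open>
  Infinite descent: if \<open>t n\<close> were a fraction, \<open>t (Suc n)\<close> would be a fraction whose
  denominator is the smaller numerator of \<open>t n\<close>.
\<close>

lemma unit_irrational_if_infinite_orbit:
  fixes t :: "nat \<Rightarrow> real" and d :: "nat \<Rightarrow> nat"
  assumes t: "\<And>n. 0 < t n \<and> t n < 1" and step: "\<And>n. t n = 1 / (real (d n) + t (Suc n))"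
  shows "t n \<in> unit_irrationals"
proof -
  have "t n \<noteq> real p / real q" if "0 < q" for n p q
    using that
  proof (induction q arbitrary: n p rule: less_induct)
    case (less q)
    show ?case
    proof
      assume eq: "t n = real p / real q"
      have p: "0 < p" "p < q"
        using t[of n] less.prems unfolding eq by (auto simp: field_simps)
      have "0 < real (d n) + t (Suc n)" using t[of "Suc n"] by (intro add_nonneg_pos) auto
      then have tS: "t (Suc n) = real q / real p - real (d n)"
        using step[of n] p less.prems unfolding eq by (simp add: field_simps)
      then have "real (d n) \<le> real q / real p" using t[of "Suc n"] by simp
      then have "real (d n * p) \<le> real q" using p by (simp add: pos_le_divide_eq)
      then have "d n * p \<le> q" by (simp only: of_nat_le_iff)
      then have "t (Suc n) = real (q - d n * p) / real p"
        unfolding tS using p by (simp add: of_nat_diff field_simps)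
      then show False using less.IH[OF p(2,1)] by blast
    qed
  qed
  then have "t n \<notin> \<rat>"
    using Rats_abs_nat_div_natE[of "t n"] t[of n] by (metis abs_of_pos gr0I)
  then show ?thesis using t by (auto simp: unit_irrationals_def)
qed

text \<open>
  The point lies in the intersection of the nested compact images of \<open>{0..1}\<close> under the inverse
  branches. Injectivity of the branches makes the preimages \<open>t n\<close> fit together, and they are
  the Gauss orbit of the point.
\<close>

lemma cf_realisation:
  fixes d :: "nat \<Rightarrow> nat"
  assumes d: "\<And>n. 1 \<le> d n"
  shows "\<exists>x\<in>unit_irrationals. \<forall>n. cf_digit x (Suc n) = d n"
proof -
  define \<phi> where "\<phi> n t = 1 / (real (d n) + t)" for n and t :: real
  define F where "F n t = foldr \<phi> [0..<n] t" for n t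
  have FSuc: "F (Suc n) t = F n (\<phi> n t)" for n t by (simp add: F_def)
  have F0: "F 0 t = t" for t by (simp add: F_def)
  have \<phi>01: "\<phi> n t \<in> {0..1}" if "t \<in> {0..1}" for n t
    using that d[of n] by (auto simp: \<phi>_def)
  have dpos: "0 < real (d n)" for n using d[of n] by linarith
  have cont: "continuous_on {0..1} (F n)" for n
  proof (induction n)
    case (Suc n)
    have "continuous_on {0..1} (\<phi> n)" unfolding \<phi>_def
      by (intro continuous_intros) (use dpos[of n] in auto)
    then have "continuous_on {0..1} (\<lambda>t. F n (\<phi> n t))"
      using continuous_on_compose2[OF Suc] \<phi>01 by blast
    then show ?case by (simp add: FSuc)
  qed (simp add: F0)
  have inj: "inj_on (F n) {0..1}" for n
  proof (induction n)
    case (Suc n)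
    show ?case
    proof (rule inj_onI)
      fix s t :: real assume st: "s \<in> {0..1}" "t \<in> {0..1}" "F (Suc n) s = F (Suc n) t"
      then have "\<phi> n s = \<phi> n t" using Suc \<phi>01 by (auto simp: FSuc dest: inj_onD)
      moreover have "real (d n) + s > 0" "real (d n) + t > 0" using st dpos[of n] by auto
      ultimately show "s = t" by (simp add: \<phi>_def)
    qed
  qed (simp add: F0)
  define K where "K n = F n ` {0..1}" for n
  have "\<Inter>(range K) \<noteq> {}"
  proof (rule compact_nest)
    show "compact (K n)" for n unfolding K_def by (intro compact_continuous_image cont) auto
    show "K n \<noteq> {}" for n by (simp add: K_def)
    have "K (Suc n) \<subseteq> K n" for n unfolding K_def using \<phi>01 by (auto simp: FSuc)
    then show "K n \<subseteq> K m" if "m \<le> n" for m n using lift_Suc_antimono_le[of K m n] that by blast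
  qed
  then obtain x where x: "\<And>n. x \<in> K n" by blast
  have "\<exists>s. s \<in> {0..1} \<and> x = F n s" for n using x[of n] unfolding K_def by blast
  then obtain t where t: "\<And>n. t n \<in> {0..1}" "\<And>n. x = F n (t n)" by metis
  have step: "t n = 1 / (real (d n) + t (Suc n))" for n
  proof -
    have "F n (t n) = F n (\<phi> n (t (Suc n)))" using t(2) FSuc by metis
    then have "t n = \<phi> n (t (Suc n))" using inj t(1) \<phi>01 by (metis inj_onD)
    then show ?thesis by (simp add: \<phi>_def)
  qed
  have tpos: "0 < t n" for n
    using step[of n] t(1)[of "Suc n"] dpos[of n] by simp
  have tlt: "t n < 1" for n
  proof -
    have "1 < real (d n) + t (Suc n)" using d[of n] tpos[of "Suc n"] by linarith
    then show ?thesis by (subst step) simp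
  qed
  have inv: "1 / t n = real (d n) + t (Suc n)" for n by (subst step) simp
  have fl: "\<lfloor>1 / t n\<rfloor> = int (d n)" for n
    unfolding inv using tpos[of "Suc n"] tlt[of "Suc n"] by (intro floor_unique) auto
  have "gauss_map (t n) = t (Suc n)" for n
    by (simp add: gauss_map_def frac_def fl) (simp add: inv)
  then have orbit: "(gauss_map ^^ n) x = t n" for n
    by (induction n) (use t(2)[of 0] in \<open>simp_all add: F0\<close>)
  have "x \<in> unit_irrationals"
  proof -
    have "t 0 \<in> unit_irrationals"
      by (rule unit_irrational_if_infinite_orbit[where d = d]) (simp add: tpos tlt, rule step)
    then show ?thesis using orbit[of 0] by simp
  qed
  moreover have "cf_digit x (Suc n) = d n" for n by (simp add: cf_digit_def orbit fl)
  ultimately show ?thesis by blast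
qed

section \<open>Steering the ratio of logarithms\<close>

text \<open>
  The quantity that has to stay bounded: the ratio of logarithms is \<open>\<alpha>\<close> plus the defect divided by
  \<open>ln (continuant w)\<close>. It is positive when the digit product is too large.
\<close>

definition defect :: "real \<Rightarrow> nat list \<Rightarrow> real" where
  "defect \<alpha> w = ln (real (prod_list w)) - \<alpha> * ln (continuant w)"

text \<open>
  Two digits \<open>1\<close> leave the product unchanged and multiply the denominator by at least \<open>2\<close>. A single
  \<open>1\<close> after a large digit would raise the denominator only by a factor close to \<open>1\<close>.
\<close>

definition steering_pad :: "real \<Rightarrow> nat list \<Rightarrow> nat list" where
  "steering_pad \<alpha> w = (if 0 < defect \<alpha> w then [1, 1] else [])"

text \<open>
  The word after \<open>k\<close> free digits \<open>\<omega> 0, \<dots>, \<omega> (k - 1)\<close>; whether a pad is inserted before \<open>\<omega> k\<close>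
  is decided by the earlier free digits alone.
\<close>

primrec steered :: "real \<Rightarrow> (nat \<Rightarrow> nat) \<Rightarrow> nat \<Rightarrow> nat list" where
  "steered \<alpha> \<omega> 0 = []"
| "steered \<alpha> \<omega> (Suc k) = steered \<alpha> \<omega> k @ steering_pad \<alpha> (steered \<alpha> \<omega> k) @ [\<omega> k]"

text \<open>
  The digit with index \<open>Suc n\<close> is read off at position \<open>n\<close> of a word that is long enough, because each
  step appends at least one digit.
\<close>

definition steered_point :: "real \<Rightarrow> (nat \<Rightarrow> nat) \<Rightarrow> real" where
  "steered_point \<alpha> \<omega> = (SOME x. x \<in> unit_irrationals \<and>
     (\<forall>n. cf_digit x (Suc n) = steered \<alpha> \<omega> (Suc n) ! n))"

lemma defect_change:
  assumes "0 \<le> \<alpha>" "0 < c" "1 \<le> b" "admissible w" "admissible w'"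
    and P: "real (prod_list w') = real (prod_list w) * b"
    and Q: "c * b * continuant w \<le> continuant w'" "continuant w' \<le> C * b * continuant w"
  shows "defect \<alpha> w + (1 - \<alpha>) * ln b - \<alpha> * ln C \<le> defect \<alpha> w'"
    and "defect \<alpha> w' \<le> defect \<alpha> w + (1 - \<alpha>) * ln b - \<alpha> * ln c"
proof -
  have q: "1 \<le> continuant w" "1 \<le> continuant w'" using continuant_bounds assms by auto
  have p: "0 < prod_list w" using assms(4) by (auto simp: prod_list_zero_iff intro!: gr0I)
  have C: "0 < C"
  proof -
    have "0 < C * b * continuant w" using Q q by linarith
    then show ?thesis using assms q by (simp add: zero_less_mult_iff)
  qed
  have lnP: "ln (real (prod_list w')) = ln (real (prod_list w)) + ln b"
    unfolding P using p assms by (subst ln_mult) auto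
  have "ln (c * b * continuant w) \<le> ln (continuant w')" using Q q assms by (subst ln_le_cancel_iff) auto
  moreover have "ln (continuant w') \<le> ln (C * b * continuant w)"
    using Q q assms C by (subst ln_le_cancel_iff) auto
  moreover have "ln (k * b * continuant w) = ln k + ln b + ln (continuant w)" if "0 < k" for k
    using that q assms by (simp add: ln_mult)
  ultimately have "ln c + ln b + ln (continuant w) \<le> ln (continuant w')"
    "ln (continuant w') \<le> ln C + ln b + ln (continuant w)" using C assms by auto
  then have "\<alpha> * (ln c + ln b + ln (continuant w)) \<le> \<alpha> * ln (continuant w')"
    "\<alpha> * ln (continuant w') \<le> \<alpha> * (ln C + ln b + ln (continuant w))"
    using assms by (auto intro: mult_left_mono)
  then show "defect \<alpha> w + (1 - \<alpha>) * ln b - \<alpha> * ln C \<le> defect \<alpha> w'"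
    and "defect \<alpha> w' \<le> defect \<alpha> w + (1 - \<alpha>) * ln b - \<alpha> * ln c"
    unfolding defect_def lnP by (auto simp: algebra_simps)
qed

lemma continuant_pad:
  "continuant (w @ [1, 1]) = 2 * continuant w + continuant_prev w"
  "continuant_prev (w @ [1, 1]) = continuant w + continuant_prev w"
proof -
  have w: "w @ [1, 1] = (w @ [1]) @ [1]" by simp
  show "continuant (w @ [1, 1]) = 2 * continuant w + continuant_prev w"
    "continuant_prev (w @ [1, 1]) = continuant w + continuant_prev w"
    unfolding w continuant_snoc by simp_all
qed

lemma continuant_padded:
  assumes "admissible w"
  shows "continuant (w @ steering_pad \<alpha> w) \<le> 3 * continuant w"
  using continuant_bounds[OF assms] by (auto simp: steering_pad_def continuant_pad[simplified])

text \<open>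
  The set \<open>A\<close> contains the free digits. By \<open>drift_up\<close> a free digit without pad does not lower the
  defect; by \<open>drift_small\<close> a free digit together with its pad does not raise it. Evenness keeps
  different digits at distance at least \<open>2\<close>, which separates the cylinders of the Cantor set.
\<close>

locale steering =
  fixes \<alpha> :: real and A :: "nat set"
  assumes \<alpha>: "0 < \<alpha>" "\<alpha> < 1"
    and A: "finite A"
    and A_pos: "a \<in> A \<Longrightarrow> 0 < a"
    and A_even: "a \<in> A \<Longrightarrow> even a"
    and drift_up: "a \<in> A \<Longrightarrow> 1 / real a \<le> (1 - \<alpha>) * ln (real a)"
    and drift_small: "a \<in> A \<Longrightarrow> (1 - \<alpha>) * ln (real a) \<le> \<alpha> * ln 2"
begin

abbreviation choices :: "(nat \<Rightarrow> nat) set" where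
  "choices \<equiv> UNIV \<rightarrow> A"

lemma admissible_steered:
  assumes "\<omega> \<in> choices" shows "admissible (steered \<alpha> \<omega> k)" "set (steered \<alpha> \<omega> k) \<subseteq> insert 1 A"
proof -
  show "set (steered \<alpha> \<omega> k) \<subseteq> insert 1 A"
    by (induction k) (use assms in \<open>auto simp: steering_pad_def\<close>)
  then show "admissible (steered \<alpha> \<omega> k)" using A_pos by (auto simp: Suc_le_eq)
qed

text \<open>
  The feedback: a positive defect does not increase and drops by at most \<open>ln 5\<close>, and a nonpositive
  defect does not decrease and rises by at most \<open>ln 2\<close>.
\<close>

lemma continuant_steered_step:
  assumes "\<omega> \<in> choices"
  shows "continuant (steered \<alpha> \<omega> (Suc k)) \<le> 5 * real (\<omega> k) * continuant (steered \<alpha> \<omega> k)"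
    and "defect \<alpha> (steered \<alpha> \<omega> k) \<in> {- ln 5..ln 2} \<Longrightarrow>
      defect \<alpha> (steered \<alpha> \<omega> (Suc k)) \<in> {- ln 5..ln 2}"
proof -
  define w w' b q q' where "w = steered \<alpha> \<omega> k" and "w' = steered \<alpha> \<omega> (Suc k)" and "b = real (\<omega> k)"
    and "q = continuant w" and "q' = continuant_prev w"
  have bA: "\<omega> k \<in> A" using assms by auto
  then have b: "1 \<le> b" using A_pos[OF bA] by (simp add: b_def)
  have adm: "admissible w" "admissible w'" using admissible_steered(1)[OF assms] by (auto simp: w_def w'_def simp del: steered.simps)
  have q: "1 \<le> q" "0 \<le> q'" "q' \<le> q" using continuant_bounds[OF adm(1)] by (auto simp: q_def q'_def)
  have w': "w' = (w @ steering_pad \<alpha> w) @ [\<omega> k]" by (simp add: w_def w'_def)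
  have bq: "q \<le> b * q" "0 \<le> b * q'" "b * q' \<le> b * q" using b q by (auto intro: mult_left_mono)
  have P: "real (prod_list w') = real (prod_list w) * b" by (simp add: w' b_def steering_pad_def)
  have "continuant w' \<le> 5 * b * q \<and>
    (defect \<alpha> w \<in> {- ln 5..ln 2} \<longrightarrow> defect \<alpha> w' \<in> {- ln 5..ln 2})"
  proof (cases "0 < defect \<alpha> w")
    case True
    have Q: "continuant w' = b * (2 * q + q') + (q + q')"
      unfolding w' continuant_snoc using True
      by (simp add: steering_pad_def continuant_pad[simplified] b_def q_def q'_def)
    have "b * (2 * q + q') = 2 * (b * q) + b * q'" by (simp add: algebra_simps)
    then have 1: "2 * b * q \<le> continuant w'" "continuant w' \<le> 5 * b * q"
      using q bq unfolding Q by linarith+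
    have "defect \<alpha> w + (1 - \<alpha>) * ln b - \<alpha> * ln 5 \<le> defect \<alpha> w'"
      "defect \<alpha> w' \<le> defect \<alpha> w + (1 - \<alpha>) * ln b - \<alpha> * ln 2"
      using defect_change[of \<alpha> 2 b w w' 5] \<alpha> b adm P 1 by (auto simp: q_def)
    moreover have "\<alpha> * ln 5 \<le> ln 5" using \<alpha> by simp
    moreover have "0 \<le> (1 - \<alpha>) * ln b" using \<alpha> b by simp
    moreover have "(1 - \<alpha>) * ln b \<le> \<alpha> * ln 2" using drift_small[OF bA] by (simp add: b_def)
    ultimately show ?thesis using 1 True unfolding atLeastAtMost_iff
      by (intro conjI impI; (elim conjE)?; linarith)
  next
    case False
    have Q: "continuant w' = b * q + q'"
      unfolding w' continuant_snoc using False
      by (simp add: steering_pad_def b_def q_def q'_def)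
    have e: "(1 + 1 / b) * b * q = b * q + q" using b by (simp add: field_simps)
    have 1: "1 * b * q \<le> continuant w'" "continuant w' \<le> (1 + 1 / b) * b * q"
      unfolding e unfolding Q using q bq by auto
    have 2: "defect \<alpha> w + (1 - \<alpha>) * ln b - \<alpha> * ln (1 + 1 / b) \<le> defect \<alpha> w'"
      "defect \<alpha> w' \<le> defect \<alpha> w + (1 - \<alpha>) * ln b - \<alpha> * ln 1"
      using defect_change[of \<alpha> 1 b w w' "1 + 1 / b"] \<alpha> b adm P 1 by (auto simp: q_def)
    have "\<alpha> * ln (1 + 1 / b) \<le> 1 * (1 / b)"
      using \<alpha> b ln_add_one_self_le_self[of "1 / b"] by (intro mult_mono) auto
    moreover have "1 / b \<le> (1 - \<alpha>) * ln b" using drift_up[OF bA] by (simp add: b_def)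
    moreover have "(1 - \<alpha>) * ln b \<le> \<alpha> * ln 2" using drift_small[OF bA] by (simp add: b_def)
    moreover have "\<alpha> * ln 2 \<le> ln 2" using \<alpha> by simp
    moreover have "continuant w' \<le> 5 * b * q" using 1(2) bq q unfolding e by linarith
    ultimately show ?thesis using 2 False unfolding atLeastAtMost_iff ln_one
      by (intro conjI impI; (elim conjE)?; linarith)
  qed
  then show "continuant (steered \<alpha> \<omega> (Suc k)) \<le> 5 * real (\<omega> k) * continuant (steered \<alpha> \<omega> k)"
    and "defect \<alpha> (steered \<alpha> \<omega> k) \<in> {- ln 5..ln 2} \<Longrightarrow>
      defect \<alpha> (steered \<alpha> \<omega> (Suc k)) \<in> {- ln 5..ln 2}"
    by (auto simp: w_def w'_def b_def q_def simp del: steered.simps)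
qed

lemma defect_steered:
  assumes "\<omega> \<in> choices" shows "defect \<alpha> (steered \<alpha> \<omega> k) \<in> {- ln 5..ln 2}"
proof (induction k)
  case (Suc k)
  then show ?case using continuant_steered_step(2)[OF assms] by blast
qed (simp add: defect_def)

lemma defect_snoc:
  assumes "a \<in> insert 1 A" "admissible w"
  shows "\<bar>defect \<alpha> (w @ [a]) - defect \<alpha> w\<bar> \<le> ln 2"
proof -
  have a: "1 \<le> real a" using assms A_pos by force
  have q: "1 \<le> continuant w" "0 \<le> continuant_prev w" "continuant_prev w \<le> continuant w"
    using continuant_bounds[OF assms(2)] by auto
  have "continuant w \<le> real a * continuant w" using a q by simp
  then have 1: "1 * real a * continuant w \<le> continuant (w @ [a])" "continuant (w @ [a]) \<le> 2 * real a * continuant w"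
    unfolding continuant_snoc using q by linarith+
  have "defect \<alpha> w + (1 - \<alpha>) * ln (real a) - \<alpha> * ln 2 \<le> defect \<alpha> (w @ [a])"
    "defect \<alpha> (w @ [a]) \<le> defect \<alpha> w + (1 - \<alpha>) * ln (real a) - \<alpha> * ln 1"
    using defect_change[of \<alpha> 1 "real a" w "w @ [a]" 2] \<alpha> a assms(2) 1 by auto
  moreover have "0 \<le> (1 - \<alpha>) * ln (real a)" using \<alpha> a by simp
  moreover have "(1 - \<alpha>) * ln (real a) \<le> \<alpha> * ln 2" using drift_small[of a] assms(1) \<alpha> by auto
  moreover have "\<alpha> * ln 2 \<le> ln 2" using \<alpha> by simp
  ultimately show ?thesis by (simp only: ln_one)
qed

lemma length_steered:
  "k \<le> length (steered \<alpha> \<omega> k)"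
  "length (steered \<alpha> \<omega> (Suc k)) \<le> length (steered \<alpha> \<omega> k) + 3"
  by (induction k) (auto simp: steering_pad_def)

lemma steered_prefix: "k \<le> l \<Longrightarrow> take (length (steered \<alpha> \<omega> k)) (steered \<alpha> \<omega> l) = steered \<alpha> \<omega> k"
proof (induction l rule: dec_induct)
  case (step l)
  have "length (steered \<alpha> \<omega> k) \<le> length (steered \<alpha> \<omega> l)"
    using arg_cong[OF step.IH, of length] by simp
  then show ?case using step.IH by simp
qed simp

lemma steered_nth:
  assumes "n < length (steered \<alpha> \<omega> k)"
  shows "steered \<alpha> \<omega> (Suc n) ! n = steered \<alpha> \<omega> k ! n"
proof -
  have n: "n < length (steered \<alpha> \<omega> (Suc n))" using length_steered(1)[of "Suc n" \<omega>] by linarith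
  show ?thesis
  proof (cases "k \<le> Suc n")
    case True
    then show ?thesis using nth_take[OF assms, of "steered \<alpha> \<omega> (Suc n)"] steered_prefix[of k "Suc n" \<omega>] by metis
  next
    case False
    then show ?thesis using nth_take[OF n, of "steered \<alpha> \<omega> k"] steered_prefix[of "Suc n" k \<omega>]
      by (metis nat_le_linear)
  qed
qed

lemma steered_point:
  assumes "\<omega> \<in> choices"
  shows "steered_point \<alpha> \<omega> \<in> unit_irrationals"
    and "digits (steered_point \<alpha> \<omega>) (length (steered \<alpha> \<omega> k)) = steered \<alpha> \<omega> k"
    and "cf_digit (steered_point \<alpha> \<omega>) (Suc n) \<in> insert 1 A"
proof -
  let ?d = "\<lambda>n. steered \<alpha> \<omega> (Suc n) ! n"
  have mem: "?d n \<in> set (steered \<alpha> \<omega> (Suc n))" for n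
    using length_steered(1)[of "Suc n" \<omega>] by (intro nth_mem) linarith
  then have "1 \<le> ?d n" for n using admissible_steered(1)[OF assms, of "Suc n"] by blast
  then have "\<exists>x. x \<in> unit_irrationals \<and> (\<forall>n. cf_digit x (Suc n) = ?d n)"
    using cf_realisation[of ?d] by blast
  then have *: "steered_point \<alpha> \<omega> \<in> unit_irrationals \<and> (\<forall>n. cf_digit (steered_point \<alpha> \<omega>) (Suc n) = ?d n)"
    unfolding steered_point_def by (rule someI_ex)
  then show "steered_point \<alpha> \<omega> \<in> unit_irrationals" by simp
  show "cf_digit (steered_point \<alpha> \<omega>) (Suc n) \<in> insert 1 A"
    using * mem[of n] admissible_steered(2)[OF assms, of "Suc n"] by (metis subsetD)
  show "digits (steered_point \<alpha> \<omega>) (length (steered \<alpha> \<omega> k)) = steered \<alpha> \<omega> k"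
  proof (rule nth_equalityI)
    fix i assume i: "i < length (digits (steered_point \<alpha> \<omega>) (length (steered \<alpha> \<omega> k)))"
    then have "digits (steered_point \<alpha> \<omega>) (length (steered \<alpha> \<omega> k)) ! i = ?d i"
      using * by (simp add: digits_def del: upt_Suc steered.simps)
    then show "digits (steered_point \<alpha> \<omega>) (length (steered \<alpha> \<omega> k)) ! i = steered \<alpha> \<omega> k ! i"
      using steered_nth i by simp
  qed simp
qed

lemma defect_digits_add:
  assumes "\<omega> \<in> choices"
  defines "x \<equiv> steered_point \<alpha> \<omega>"
  shows "\<bar>defect \<alpha> (digits x (n + j)) - defect \<alpha> (digits x n)\<bar> \<le> real j * ln 2"
proof (induction j)
  case (Suc j)
  have "\<bar>defect \<alpha> (digits x (n + Suc j)) - defect \<alpha> (digits x (n + j))\<bar> \<le> ln 2"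
    using defect_snoc[OF steered_point(3)[OF assms(1), of "n + j"] admissible_digits[OF steered_point(1)[OF assms(1)], of "n + j"]]
    by (simp add: digits_Suc x_def)
  then show ?case using Suc by (simp add: algebra_simps)
qed simp

text \<open>
  The defect is controlled at the ends of the steps. A step has at most three digits and a single digit
  changes the defect by at most \<open>ln 2\<close>, so the defect is bounded along all prefixes.
\<close>

lemma steered_point_in_level_set:
  assumes \<omega>: "\<omega> \<in> choices"
  shows "steered_point \<alpha> \<omega> \<in> level_set \<alpha>"
proof -
  define x where "x = steered_point \<alpha> \<omega>"
  define len where "len k = length (steered \<alpha> \<omega> k)" for k
  have xu: "x \<in> unit_irrationals" unfolding x_def by (rule steered_point[OF \<omega>])
  have bdd: "\<bar>defect \<alpha> (digits x n)\<bar> \<le> ln 5 + 4 * ln 2" for n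
  proof -
    \<comment> \<open>A word of completed steps is at most three digits shorter than the prefix of length \<open>n\<close>.\<close>
    have ex: "\<exists>k. len k \<le> n \<and> n \<le> len k + 3"
    proof (induction n)
      case 0
      have "len 0 = 0" by (simp add: len_def)
      then show ?case by auto
    next
      case (Suc n)
      then obtain k where k: "len k \<le> n" "n \<le> len k + 3" by blast
      have "len k < len (Suc k)" "len (Suc k) \<le> len k + 3"
        using length_steered(2) by (auto simp: len_def)
      show ?case
      proof (cases "n = len k + 3")
        case True
        then have "len (Suc k) \<le> Suc n \<and> Suc n \<le> len (Suc k) + 3"
          using \<open>len k < len (Suc k)\<close> \<open>len (Suc k) \<le> len k + 3\<close> by linarith
        then show ?thesis by blast
      next
        case False
        then have "len k \<le> Suc n \<and> Suc n \<le> len k + 3" using k by linarith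
        then show ?thesis by blast
      qed
    qed
    then obtain k where k: "len k \<le> n" "n \<le> len k + 3" by blast
    have "digits x (len k) = steered \<alpha> \<omega> k" unfolding x_def len_def by (rule steered_point(2)[OF \<omega>])
    then have 1: "defect \<alpha> (digits x (len k)) \<in> {- ln 5..ln 2}" using defect_steered[OF \<omega>] by simp
    have "\<bar>defect \<alpha> (digits x n) - defect \<alpha> (digits x (len k))\<bar> \<le> real (n - len k) * ln 2"
      using defect_digits_add[OF \<omega>, of "len k" "n - len k"] k by (simp add: x_def)
    also have "\<dots> \<le> 3 * ln 2" using k by (intro mult_right_mono) auto
    finally show ?thesis using 1 ln_ge_zero[of 2] ln_ge_zero[of 5] unfolding atLeastAtMost_iff by linarith
  qed
  have top: "filterlim (\<lambda>n. ln (continuant (digits x n))) at_top sequentially"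
    using filterlim_compose[OF ln_at_top continuant_digits_at_top[OF xu]] .
  have "(\<lambda>n. defect \<alpha> (digits x n) / ln (continuant (digits x n))) \<longlonglongrightarrow> 0"
  proof (rule Lim_null_comparison)
    show "(\<lambda>n. (ln 5 + 4 * ln 2) / ln (continuant (digits x n))) \<longlonglongrightarrow> 0"
      using tendsto_divide_0[OF tendsto_const filterlim_at_top_imp_at_infinity[OF top]] .
    show "\<forall>\<^sub>F n in sequentially. norm (defect \<alpha> (digits x n) / ln (continuant (digits x n)))
        \<le> (ln 5 + 4 * ln 2) / ln (continuant (digits x n))"
    proof (rule always_eventually, rule allI)
      fix n
      have "0 \<le> ln (continuant (digits x n))"
        using continuant_bounds[OF admissible_digits[OF xu, of n]] by simp
      then show "norm (defect \<alpha> (digits x n) / ln (continuant (digits x n)))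
        \<le> (ln 5 + 4 * ln 2) / ln (continuant (digits x n))"
        using bdd[of n] by (simp add: divide_right_mono)
    qed
  qed
  then have "(\<lambda>n. \<alpha> + defect \<alpha> (digits x n) / ln (continuant (digits x n))) \<longlonglongrightarrow> \<alpha> + 0"
    by (intro tendsto_intros)
  moreover have "\<forall>\<^sub>F n in sequentially. \<alpha> + defect \<alpha> (digits x n) / ln (continuant (digits x n))
      = ln (real (prod_list (digits x n))) / ln (continuant (digits x n))"
  proof -
    have "\<forall>\<^sub>F n in sequentially. 0 < ln (continuant (digits x n))"
      using top by (simp add: filterlim_at_top_dense)
    then show ?thesis by eventually_elim (simp add: defect_def field_simps)
  qed
  ultimately have "(\<lambda>n. ln (real (prod_list (digits x n))) / ln (continuant (digits x n))) \<longlonglongrightarrow> \<alpha>"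
    using Lim_transform_eventually by fastforce
  then show ?thesis using xu unfolding level_set_iff x_def by simp
qed

lemma steered_cong:
  "(\<And>i. i < k \<Longrightarrow> \<omega> i = \<omega>' i) \<Longrightarrow> steered \<alpha> \<omega> k = steered \<alpha> \<omega>' k"
  by (induction k) auto

lemma digits_after_pad:
  fixes k :: nat
  assumes "\<omega> \<in> choices"
  defines "w \<equiv> steered \<alpha> \<omega> k"
  defines "n \<equiv> length (w @ steering_pad \<alpha> w)"
  shows "digits (steered_point \<alpha> \<omega>) n = w @ steering_pad \<alpha> w"
    and "cf_digit (steered_point \<alpha> \<omega>) (Suc n) = \<omega> k"
proof -
  have "digits (steered_point \<alpha> \<omega>) (Suc n) = (w @ steering_pad \<alpha> w) @ [\<omega> k]"
    using steered_point(2)[OF assms(1), of "Suc k"] by (simp add: w_def n_def)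
  then show "digits (steered_point \<alpha> \<omega>) n = w @ steering_pad \<alpha> w"
    and "cf_digit (steered_point \<alpha> \<omega>) (Suc n) = \<omega> k"
    unfolding digits_Suc by auto
qed

text \<open>
  The points share all digits up to and including the pad that follows the common word. The next digits
  are different even numbers, so the denominators \<open>a + s\<close> and \<open>b + t\<close> differ by at least \<open>1\<close>.
  In the constant, \<open>9\<close> accounts for the pad and \<open>4\<close> for the distortion of the inverse branches.
\<close>

lemma steered_separation:
  assumes \<omega>: "\<omega> \<in> choices" and \<omega>': "\<omega>' \<in> choices" and pre: "\<And>i. i < k \<Longrightarrow> \<omega> i = \<omega>' i" and "\<omega> k \<noteq> \<omega>' k"
    and M: "\<And>a. a \<in> A \<Longrightarrow> real a \<le> M"
  shows "continuant (steered \<alpha> \<omega> k) powr (-2) / (36 * (M + 1)\<^sup>2)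
    \<le> \<bar>steered_point \<alpha> \<omega> - steered_point \<alpha> \<omega>'\<bar>"
proof -
  define x y w v n a b where "x = steered_point \<alpha> \<omega>" and "y = steered_point \<alpha> \<omega>'"
    and "w = steered \<alpha> \<omega> k" and "v = w @ steering_pad \<alpha> w" and "n = length v" and "a = \<omega> k" and "b = \<omega>' k"
  have w': "w = steered \<alpha> \<omega>' k" unfolding w_def using pre by (rule steered_cong)
  have x: "x \<in> unit_irrationals" "digits x n = v" "cf_digit x (Suc n) = a"
    using steered_point(1)[OF \<omega>] digits_after_pad[OF \<omega>, of k] unfolding x_def n_def v_def w_def a_def by auto
  have y: "y \<in> unit_irrationals" "digits y n = v" "cf_digit y (Suc n) = b"
    using steered_point(1)[OF \<omega>'] digits_after_pad[OF \<omega>', of k] unfolding y_def n_def v_def w' b_def by auto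
  define s t where "s = (gauss_map ^^ Suc n) x" and "t = (gauss_map ^^ Suc n) y"
  have st: "0 < s" "s < 1" "0 < t" "t < 1"
    using unit_irrationalsD[OF gauss_map_funpow_unit_irrationals[OF x(1), of "Suc n"]]
      unit_irrationalsD[OF gauss_map_funpow_unit_irrationals[OF y(1), of "Suc n"]]
    unfolding s_def t_def by auto
  have Tx: "(gauss_map ^^ n) x = 1 / (real a + s)" and Ty: "(gauss_map ^^ n) y = 1 / (real b + t)"
    using gauss_map_step[OF x(1), of n] gauss_map_step[OF y(1), of n] x y unfolding s_def t_def by auto
  have ab: "a \<in> A" "b \<in> A" using \<omega> \<omega>' by (auto simp: a_def b_def)
  have "\<bar>real a - real b\<bar> \<ge> 2"
  proof -
    have "a \<noteq> b" "even a" "even b" using assms(4) A_even ab by (auto simp: a_def b_def)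
    then have "a + 2 \<le> b \<or> b + 2 \<le> a" by presburger
    then show ?thesis by auto
  qed
  then have num: "1 \<le> \<bar>(real b + t) - (real a + s)\<bar>" using st by linarith
  have pos: "0 < real a + s" "0 < real b + t" using st by auto
  have "(real a + s) * (real b + t) \<le> (M + 1) * (M + 1)"
    using M[OF ab(1)] M[OF ab(2)] st by (intro mult_mono) auto
  then have den: "(real a + s) * (real b + t) \<le> (M + 1)\<^sup>2" by (simp add: power2_eq_square)
  have "1 / (real a + s) - 1 / (real b + t) = ((real b + t) - (real a + s)) / ((real a + s) * (real b + t))"
    using pos by (simp add: field_simps)
  then have "\<bar>1 / (real a + s) - 1 / (real b + t)\<bar> = \<bar>(real b + t) - (real a + s)\<bar> / ((real a + s) * (real b + t))"
    using pos by (simp add: abs_mult)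
  moreover have "1 / (M + 1)\<^sup>2 \<le> \<bar>(real b + t) - (real a + s)\<bar> / ((real a + s) * (real b + t))"
    using num den pos by (intro frac_le) auto
  ultimately have gap: "1 / (M + 1)\<^sup>2 \<le> \<bar>(gauss_map ^^ n) x - (gauss_map ^^ n) y\<bar>" by (simp add: Tx Ty)
  have adm: "admissible w" unfolding w_def by (rule admissible_steered(1)[OF \<omega>])
  have q: "1 \<le> continuant w" using continuant_bounds[OF adm] by simp
  have v1: "1 \<le> continuant v" using continuant_bounds[OF admissible_digits[OF x(1), of n]] x(2) by simp
  have "continuant w powr (-2) / 9 = (3 * continuant w) powr (-2)"
    using q by (simp add: powr_minus_divide power_mult_distrib)
  also have "\<dots> \<le> continuant v powr (-2)"
    using continuant_padded[OF adm, of \<alpha>] v1 q unfolding v_def by (intro powr_mono2') auto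
  finally have 9: "continuant w powr (-2) / 9 \<le> continuant v powr (-2)" .
  have "continuant w powr (-2) / (36 * (M + 1)\<^sup>2) = (1 / (M + 1)\<^sup>2) / 4 * (continuant w powr (-2) / 9)" by simp
  also have "\<dots> \<le> \<bar>(gauss_map ^^ n) x - (gauss_map ^^ n) y\<bar> / 4 * continuant v powr (-2)"
    using gap 9 by (intro mult_mono) auto
  also have "\<dots> \<le> \<bar>x - y\<bar>"
    using cylinder_distance_bounds(2)[OF x(1) y(1), of n] x y by simp
  finally show ?thesis unfolding x_def y_def w_def .
qed

end

section \<open>Lower bound for the dimension\<close>

lemma hausdorff_dim_ge:
  assumes "\<And>s'. 0 \<le> s' \<Longrightarrow> s' < s \<Longrightarrow>
    \<exists>c>0. \<forall>U\<in>delta_covers 1 A. ennreal c \<le> (\<Sum>i. diam_power s' (U i))"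
  shows "ereal s \<le> hausdorff_dim A"
  unfolding hausdorff_dim_def
proof (rule INF_greatest)
  fix s' assume s': "s' \<in> {s. 0 \<le> s \<and> hausdorff_measure s A = 0}"
  show "ereal s \<le> ereal s'"
  proof (rule ccontr)
    assume "\<not> ereal s \<le> ereal s'"
    then obtain c where c: "0 < c" "\<And>U. U \<in> delta_covers 1 A \<Longrightarrow> ennreal c \<le> (\<Sum>i. diam_power s' (U i))"
      using assms[of s'] s' by auto
    have "ennreal c \<le> hausdorff_premeasure s' 1 A"
      unfolding hausdorff_premeasure_def using c(2) by (intro INF_greatest)
    also have "\<dots> \<le> hausdorff_measure s' A"
      unfolding hausdorff_measure_def by (intro SUP_upper) simp
    finally show False using s' c(1) by simp
  qed
qed

definition code_cylinder :: "(nat \<Rightarrow> 'a) \<Rightarrow> nat \<Rightarrow> (nat \<Rightarrow> 'a) set" where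
  "code_cylinder \<omega> k = {\<omega>'. \<forall>i<k. \<omega>' i = \<omega> i}"

context
  fixes p :: "nat pmf"
begin

definition code_measure :: "(nat \<Rightarrow> nat) measure" where
  "code_measure = PiM UNIV (\<lambda>_. measure_pmf p)"

lemma space_code_measure [simp]: "space code_measure = UNIV"
  by (simp add: code_measure_def space_PiM)

lemma code_cylinder_measure:
  "code_cylinder \<omega> k \<in> sets code_measure"
  "emeasure code_measure (code_cylinder \<omega> k) = ennreal (\<Prod>i<k. pmf p (\<omega> i))"
proof -
  interpret product_prob_space "\<lambda>_::nat. measure_pmf p" UNIV by standard
  have eq: "code_cylinder \<omega> k = {\<omega>'\<in>space code_measure. \<forall>i\<in>{..<k}. \<omega>' i \<in> {\<omega> i}}"
    by (auto simp: code_cylinder_def)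
  show "code_cylinder \<omega> k \<in> sets code_measure"
    unfolding eq code_measure_def by (intro sets.sets_Collect_finite_All sets_Collect_single') auto
  have "emeasure code_measure (code_cylinder \<omega> k) = (\<Prod>i<k. emeasure (measure_pmf p) {\<omega> i})"
    unfolding eq unfolding code_measure_def by (rule emeasure_PiM_Collect) auto
  also have "\<dots> = ennreal (\<Prod>i<k. pmf p (\<omega> i))"
    by (simp add: emeasure_pmf_single prod_ennreal)
  finally show "emeasure code_measure (code_cylinder \<omega> k) = ennreal (\<Prod>i<k. pmf p (\<omega> i))" .
qed

text \<open>
  Almost every random sequence has all its entries in the support of \<open>p\<close>, so the covering sets carry
  the full mass.
\<close>

lemma code_cover_mass:
  assumes "range V \<subseteq> sets code_measure" "(UNIV \<rightarrow> set_pmf p) \<subseteq> (\<Union>i::nat. V i)"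
  shows "1 \<le> (\<Sum>i. emeasure code_measure (V i))"
proof -
  interpret product_prob_space "\<lambda>_::nat. measure_pmf p" UNIV by standard
  have "AE \<omega> in code_measure. \<omega> i \<in> set_pmf p" for i
    unfolding code_measure_def by (rule AE_component) (auto simp: AE_measure_pmf)
  then have "AE \<omega> in code_measure. \<forall>i. \<omega> i \<in> set_pmf p" by (simp add: AE_all_countable)
  then have "AE \<omega> in code_measure. \<omega> \<in> (\<Union>i. V i)"
    by eventually_elim (use assms(2) in auto)
  then have "emeasure code_measure (space code_measure) = emeasure code_measure (\<Union>i. V i)"
    using assms(1) sets.top[of code_measure] by (intro emeasure_eq_AE) auto
  moreover have "emeasure code_measure (space code_measure) = 1"
    unfolding code_measure_def by (rule P.emeasure_space_1)
  ultimately show ?thesis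
    using emeasure_subadditive_countably[OF assms(1)] by simp
qed

end

lemma pmf_dominated_by:
  fixes f :: "'a \<Rightarrow> real"
  assumes "finite A" "\<And>a. a \<in> A \<Longrightarrow> 0 < f a" "1 \<le> (\<Sum>a\<in>A. f a)"
  obtains p where "set_pmf p = A" "\<And>a. a \<in> A \<Longrightarrow> pmf p a \<le> f a"
proof -
  define S where "S = (\<Sum>a\<in>A. f a)"
  define g where "g a = (if a \<in> A then f a / S else 0)" for a
  have S: "1 \<le> S" using assms by (simp add: S_def)
  have g0: "0 \<le> g a" for a using assms(2)[of a] S by (auto simp: g_def less_imp_le)
  have "(\<integral>\<^sup>+a. ennreal (g a) \<partial>count_space UNIV) = (\<Sum>a\<in>A. ennreal (g a))"
    using assms(1) by (intro nn_integral_count_space') (auto simp: g_def)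
  also have "\<dots> = ennreal (\<Sum>a\<in>A. g a)" using g0 by (simp add: sum_ennreal)
  also have "(\<Sum>a\<in>A. g a) = 1"
    using S by (simp add: g_def sum_divide_distrib[symmetric] S_def[symmetric])
  finally have one: "(\<integral>\<^sup>+a. ennreal (g a) \<partial>count_space UNIV) = 1" by simp
  have pmf: "pmf (embed_pmf g) a = g a" for a by (rule pmf_embed_pmf[OF g0 one])
  show ?thesis
  proof (rule that[of "embed_pmf g"])
    show "set_pmf (embed_pmf g) = A"
      unfolding set_embed_pmf[OF g0 one] using assms(2) S by (auto simp: g_def) (metis less_irrefl)
    fix a assume a: "a \<in> A"
    have "f a / S \<le> f a / 1" using S assms(2)[OF a] by (intro divide_left_mono) auto
    then show "pmf (embed_pmf g) a \<le> f a" using a by (simp add: pmf g_def)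
  qed
qed

context steering
begin

lemma steered_continuant_powr_le:
  assumes \<omega>: "\<omega> \<in> choices" and "0 \<le> s"
  shows "(\<Prod>i<k. (5 * real (\<omega> i)) powr (-2 * s)) \<le> continuant (steered \<alpha> \<omega> k) powr (-2 * s)"
proof (induction k)
  case (Suc k)
  have q: "1 \<le> continuant (steered \<alpha> \<omega> j)" for j
    using continuant_bounds[OF admissible_steered(1)[OF \<omega>]] by blast
  have "(\<Prod>i<Suc k. (5 * real (\<omega> i)) powr (-2 * s))
      \<le> continuant (steered \<alpha> \<omega> k) powr (-2 * s) * (5 * real (\<omega> k)) powr (-2 * s)"
    using Suc by (simp add: mult_right_mono del: powr_mult)
  also have "\<dots> = (5 * real (\<omega> k) * continuant (steered \<alpha> \<omega> k)) powr (-2 * s)"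
    using q[of k] by (subst powr_mult[of "5 * real (\<omega> k)"]) auto
  also have "\<dots> \<le> continuant (steered \<alpha> \<omega> (Suc k)) powr (-2 * s)"
    using continuant_steered_step(1)[OF \<omega>, of k] q[of "Suc k"] \<open>0 \<le> s\<close>
    by (intro powr_mono2') auto
  finally show ?case .
qed simp

text \<open>
  Mass distribution principle. The probabilities of the free digits are at most
  \<open>(5 * a) powr (-2 * s)\<close>, so a code cylinder has mass at most \<open>q powr (-2 * s)\<close>, where \<open>q\<close> is the
  denominator of its word. If a covering set \<open>U\<close> contains two coded points, all
  its codes lie in the cylinder of their longest common prefix, and the separation of the points
  bounds the mass of this cylinder by a constant times \<open>diameter U powr s'\<close>. The constant may depend on
  the finite set of digits.
\<close>

lemma dim_spectrum_ge:
  assumes s: "0 < s" and full: "1 \<le> (\<Sum>a\<in>A. (5 * real a) powr (-2 * s))"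
  shows "ereal s \<le> dim_spectrum \<alpha>"
  unfolding dim_spectrum_def
proof (rule hausdorff_dim_ge)
  fix s' assume s': "0 \<le> s'" "s' < s"
  obtain p where p: "set_pmf p = A" "\<And>a. a \<in> A \<Longrightarrow> pmf p a \<le> (5 * real a) powr (-2 * s)"
    using pmf_dominated_by[OF A _ full] A_pos by (metis mult_pos_pos of_nat_0_less_iff powr_gt_zero zero_less_numeral less_irrefl)
  obtain M where M: "\<And>a. a \<in> A \<Longrightarrow> real a \<le> M" "0 \<le> M"
  proof
    show "real a \<le> real (Max (insert 0 A))" if "a \<in> A" for a using that A by simp
  qed simp
  define c where "c = 1 / (36 * (M + 1)\<^sup>2)"
  have c: "0 < c" unfolding c_def using M(2) by simp
  define mass where "mass \<omega> k = (\<Prod>i<k. pmf p (\<omega> i))" for \<omega> and k :: nat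
  have mass_nonneg: "0 \<le> mass \<omega> k" for \<omega> k by (simp add: mass_def prod_nonneg)
  have mass_le: "mass \<omega> k \<le> continuant (steered \<alpha> \<omega> k) powr (-2 * s)"
    and mass_small: "mass \<omega> k \<le> (5 powr (-2 * s)) ^ k" if \<omega>: "\<omega> \<in> choices" for \<omega> k
  proof -
    have in_A: "\<omega> i \<in> A" for i using \<omega> by auto
    have "mass \<omega> k \<le> (\<Prod>i<k. (5 * real (\<omega> i)) powr (-2 * s))"
      unfolding mass_def using p(2)[OF in_A] by (intro prod_mono) auto
    also have "\<dots> \<le> continuant (steered \<alpha> \<omega> k) powr (-2 * s)"
      using s by (intro steered_continuant_powr_le \<omega>) auto
    finally show "mass \<omega> k \<le> continuant (steered \<alpha> \<omega> k) powr (-2 * s)" .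
    have "pmf p (\<omega> i) \<le> 5 powr (-2 * s)" for i
    proof -
      have "1 \<le> real (\<omega> i)" using A_pos[OF in_A[of i]] by simp
      then have "(5 * real (\<omega> i)) powr (-2 * s) \<le> 5 powr (-2 * s)"
        using s by (intro powr_mono2') auto
      then show ?thesis using p(2)[OF in_A[of i]] by linarith
    qed
    then have "mass \<omega> k \<le> (\<Prod>i<k. 5 powr (-2 * s))"
      unfolding mass_def by (intro prod_mono) auto
    then show "mass \<omega> k \<le> (5 powr (-2 * s)) ^ k" by simp
  qed
  have decay: "\<exists>k. (5 powr (-2 * s)) ^ k \<le> e" if "0 < e" for e :: real
  proof -
    have "5 powr (-2 * s) < 5 powr 0" using s by (intro powr_less_mono) auto
    then show ?thesis using real_arch_pow_inv[OF that, of "5 powr (-2 * s)"] by (auto intro: less_imp_le)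
  qed
  have main: "ennreal (c powr s' / 2) \<le> (\<Sum>i. diam_power s' (U i))" if U: "U \<in> delta_covers 1 (level_set \<alpha>)" for U
  proof -
    have cov: "level_set \<alpha> \<subseteq> (\<Union>i. U i)" and bd: "\<And>i. bounded (U i)"
      using U by (auto simp: delta_covers_def)
    have "\<exists>V. V \<in> sets (code_measure p) \<and> {\<omega>\<in>choices. steered_point \<alpha> \<omega> \<in> U i} \<subseteq> V \<and>
        emeasure (code_measure p) V \<le> ennreal (c powr (-s')) * diam_power s' (U i) + ennreal ((1/2) ^ Suc (Suc i))" for i
    proof -
      \<comment> \<open>A single coded point has diameter \<open>0\<close>; the summable error pays for a thin cylinder around it.\<close>
      define P where "P = {\<omega>\<in>choices. steered_point \<alpha> \<omega> \<in> U i}"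
      consider "P = {}" | \<omega> where "\<omega> \<in> P" "P \<subseteq> {\<omega>}" | k where "\<exists>\<omega>\<in>P. \<exists>\<omega>'\<in>P. \<omega> k \<noteq> \<omega>' k"
        by blast
      then have "\<exists>V. V \<in> sets (code_measure p) \<and> P \<subseteq> V \<and>
        emeasure (code_measure p) V \<le> ennreal (c powr (-s')) * diam_power s' (U i) + ennreal ((1/2) ^ Suc (Suc i))"
      proof cases
        case 1
        then show ?thesis by (intro exI[of _ "{}"]) auto
      next
        case (2 \<omega>)
        obtain k where k: "(5 powr (-2 * s)) ^ k \<le> (1/2) ^ Suc (Suc i)" using decay[of "(1/2) ^ Suc (Suc i)"] by auto
        have "mass \<omega> k \<le> (1/2) ^ Suc (Suc i)"
          using mass_small[of \<omega> k] k 2 by (auto simp: P_def)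
        then have "emeasure (code_measure p) (code_cylinder \<omega> k) \<le> ennreal ((1/2) ^ Suc (Suc i))"
          unfolding code_cylinder_measure(2) mass_def[symmetric] by (rule ennreal_leI)
        then have "emeasure (code_measure p) (code_cylinder \<omega> k)
            \<le> ennreal (c powr (-s')) * diam_power s' (U i) + ennreal ((1/2) ^ Suc (Suc i))"
          by (intro add_increasing) auto
        moreover have "P \<subseteq> code_cylinder \<omega> k" using 2 by (auto simp: code_cylinder_def)
        ultimately show ?thesis
          by (intro exI[of _ "code_cylinder \<omega> k"] conjI code_cylinder_measure(1))
      next
        case (3 k)
        \<comment> \<open>The first position at which two codes of \<open>P\<close> disagree ends the longest common prefix.\<close>
        define j where "j = (LEAST k. \<exists>\<omega>\<in>P. \<exists>\<omega>'\<in>P. \<omega> k \<noteq> \<omega>' k)"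
        have "\<exists>\<omega>\<in>P. \<exists>\<omega>'\<in>P. \<omega> j \<noteq> \<omega>' j" unfolding j_def using 3 by (rule LeastI)
        then obtain \<omega> \<omega>' where w: "\<omega> \<in> P" "\<omega>' \<in> P" "\<omega> j \<noteq> \<omega>' j" by blast
        have agree: "\<omega>1 i = \<omega>2 i" if "\<omega>1 \<in> P" "\<omega>2 \<in> P" "i < j" for \<omega>1 \<omega>2 i
          using not_less_Least[of i] that unfolding j_def by blast
        define q where "q = continuant (steered \<alpha> \<omega> j)"
        have q: "1 \<le> q" unfolding q_def
          using continuant_bounds[OF admissible_steered(1)[of \<omega> j]] w by (auto simp: P_def)
        have mem: "steered_point \<alpha> \<omega> \<in> U i" "steered_point \<alpha> \<omega>' \<in> U i" using w by (auto simp: P_def)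
        have "c * q powr (-2) \<le> \<bar>steered_point \<alpha> \<omega> - steered_point \<alpha> \<omega>'\<bar>"
          using steered_separation[of \<omega> \<omega>' j M] w agree M by (auto simp: P_def c_def q_def)
        also have "\<dots> \<le> diameter (U i)"
          using diameter_bounded_bound[OF bd mem] by (simp add: dist_real_def)
        finally have "(c * q powr (-2)) powr s' \<le> diameter (U i) powr s'"
          using s' c by (intro powr_mono2) auto
        moreover have "(c * q powr (-2)) powr s' = c powr s' * q powr (-2 * s')"
          using c q by (simp add: powr_mult powr_powr)
        ultimately have d: "c powr s' * q powr (-2 * s') \<le> diameter (U i) powr s'" by simp
        have "c powr (-s') * c powr s' = 1" using c by (simp add: powr_add[symmetric])
        then have "q powr (-2 * s') = c powr (-s') * (c powr s' * q powr (-2 * s'))"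
          by (simp only: mult.assoc[symmetric] mult_1)
        also have "\<dots> \<le> c powr (-s') * diameter (U i) powr s'"
          using d by (intro mult_left_mono) auto
        finally have 1: "q powr (-2 * s') \<le> c powr (-s') * diameter (U i) powr s'" .
        have "mass \<omega> j \<le> q powr (-2 * s)" unfolding q_def using w by (intro mass_le) (auto simp: P_def)
        also have "\<dots> \<le> q powr (-2 * s')" using q s' by (intro powr_mono) auto
        finally have m: "mass \<omega> j \<le> q powr (-2 * s')" .
        have "ennreal (mass \<omega> j) \<le> ennreal (c powr (-s')) * diam_power s' (U i)"
        proof (cases "s' = 0")
          case True
          then show ?thesis using m mem q c by (auto simp: diam_power_def)
        next
          case False
          then have "ennreal (c powr (-s')) * diam_power s' (U i) = ennreal (c powr (-s') * diameter (U i) powr s')"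
            using mem by (auto simp: diam_power_def ennreal_mult)
          then show ?thesis using m 1 by (auto intro: ennreal_leI)
        qed
        then have "emeasure (code_measure p) (code_cylinder \<omega> j)
            \<le> ennreal (c powr (-s')) * diam_power s' (U i) + ennreal ((1/2) ^ Suc (Suc i))"
          unfolding code_cylinder_measure(2) mass_def[symmetric] by (intro add_increasing2) auto
        moreover have "P \<subseteq> code_cylinder \<omega> j" using w agree by (auto simp: code_cylinder_def)
        ultimately show ?thesis
          by (intro exI[of _ "code_cylinder \<omega> j"] conjI code_cylinder_measure(1))
      qed
      then show ?thesis unfolding P_def .
    qed
    then have "\<exists>V. \<forall>i. V i \<in> sets (code_measure p) \<and> {\<omega>\<in>choices. steered_point \<alpha> \<omega> \<in> U i} \<subseteq> V i \<and>
        emeasure (code_measure p) (V i) \<le> ennreal (c powr (-s')) * diam_power s' (U i) + ennreal ((1/2) ^ Suc (Suc i))"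
      by (intro choice allI)
    then obtain V where V: "\<And>i. V i \<in> sets (code_measure p)"
      "\<And>i. {\<omega>\<in>choices. steered_point \<alpha> \<omega> \<in> U i} \<subseteq> V i"
      "\<And>i. emeasure (code_measure p) (V i) \<le> ennreal (c powr (-s')) * diam_power s' (U i) + ennreal ((1/2) ^ Suc (Suc i))"
      by (elim exE) blast
    have "choices \<subseteq> (\<Union>i. V i)"
    proof
      fix \<omega> assume "\<omega> \<in> choices"
      moreover from this obtain i where "steered_point \<alpha> \<omega> \<in> U i" using cov steered_point_in_level_set by blast
      ultimately show "\<omega> \<in> (\<Union>i. V i)" using V(2) by blast
    qed
    then have "1 \<le> (\<Sum>i. emeasure (code_measure p) (V i))"
      using V(1) by (intro code_cover_mass) (auto simp: p)
    also have "\<dots> \<le> (\<Sum>i. ennreal (c powr (-s')) * diam_power s' (U i) + ennreal ((1/2) ^ Suc (Suc i)))"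
      using V(3) by (intro suminf_le) auto
    also have "\<dots> = ennreal (c powr (-s')) * (\<Sum>i. diam_power s' (U i)) + (\<Sum>i. ennreal ((1/2) ^ Suc (Suc i)))"
      by (simp add: suminf_add[symmetric])
    also have "(\<Sum>i. ennreal ((1/2) ^ Suc (Suc i))) = ennreal (1 / 2)"
    proof (rule suminf_ennreal_eq)
      show "(\<lambda>i. (1/2::real) ^ Suc (Suc i)) sums (1 / 2)"
        using sums_mult[OF power_half_series, of "1/2"] by simp
    qed simp
    finally have total: "1 \<le> ennreal (c powr (-s')) * (\<Sum>i. diam_power s' (U i)) + ennreal (1 / 2)" .
    show ?thesis
    proof (cases "(\<Sum>i. diam_power s' (U i))")
      case (real D)
      have "ennreal 1 \<le> ennreal (c powr (-s') * D + 1 / 2)"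
        using total real by (simp add: ennreal_mult ennreal_plus)
      then have "1 / 2 \<le> c powr (-s') * D" using real by (subst (asm) ennreal_le_iff) auto
      then have "c powr s' * (1 / 2) \<le> c powr s' * (c powr (-s') * D)" by (intro mult_left_mono) auto
      also have "\<dots> = D" using c by (simp add: powr_add[symmetric] mult.assoc[symmetric])
      finally show ?thesis using real by (auto intro: ennreal_leI)
    qed simp
  qed
  have "0 < c powr s' / 2" using c by simp
  then show "\<exists>c>0. \<forall>U\<in>delta_covers 1 (level_set \<alpha>). ennreal c \<le> (\<Sum>i. diam_power s' (U i))"
    using main by blast
qed

end

section \<open>Choice of the parameters\<close>

text \<open>
  With \<open>\<gamma> = 1 - 2 * \<epsilon>\<close> and \<open>t = h / (2 * \<epsilon>)\<close> the relation between the exponents becomes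
  \<open>s = 1/2 + h\<close>. The sum of the weights is roughly \<open>exp (- h * L / 4) / h\<close>, which is small
  for \<open>h = 16 * ln L / L\<close>.
\<close>

lemma dim_spectrum_le_loglog:
  "\<forall>\<^sub>F L in at_top. dim_spectrum (1 - exp (- L)) \<le> ereal (1 / 2 + 16 * (ln L / L))"
proof -
  have "\<forall>\<^sub>F L in at_top. 16 * (ln L / L) \<le> (2 :: real)" by real_asymp
  moreover have "\<forall>\<^sub>F L in at_top. (2 :: real) \<le> 16 * (ln L / L) / (2 * exp (- L))" by real_asymp
  moreover have "\<forall>\<^sub>F L :: real in at_top. (16 * (ln L / L) / (2 * exp (- L)) / 2) powr (-(16 * (ln L / L) / 4)) *
      (1 + 2 / (16 * (ln L / L))) \<le> 1 / 2" by real_asymp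
  moreover have "\<forall>\<^sub>F L :: real in at_top. 0 < 16 * (ln L / L)" by real_asymp
  ultimately show ?thesis
  proof eventually_elim
    case (elim L)
    define h where "h = 16 * (ln L / L)"
    define t where "t = h / (2 * exp (- L))"
    note e = elim[folded h_def, folded t_def]
    show ?case
      unfolding h_def[symmetric]
    proof (rule dim_spectrum_le)
      show "2 \<le> t" "0 < h" "h \<le> 2" "0 < 1 / 2 + h" "(t / 2) powr (-(h / 4)) * (1 + 2 / h) \<le> 1 / 2"
        using e by auto
      show "2 * (1 / 2 + h) + t * (1 - 2 * exp (- L)) = t + 1 + h"
        by (simp add: t_def field_simps)
      show "1 - 2 * exp (- L) < 1 - exp (- L)" by simp
    qed
  qed
qed

lemma ln_le_sum_inverse:
  assumes "0 < N" "N \<le> Suc M"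
  shows "ln (real (Suc M)) - ln (real N) \<le> (\<Sum>j=N..M. 1 / real j)"
  using assms(2)
proof (induction M)
  case 0
  then show ?case using assms(1) by (cases "N = 1") auto
next
  case (Suc M)
  show ?case
  proof (cases "N = Suc (Suc M)")
    case False
    have "real (Suc (Suc M)) = real (Suc M) * (1 + 1 / real (Suc M))" by (simp add: field_simps)
    then have "ln (real (Suc (Suc M))) = ln (real (Suc M)) + ln (1 + 1 / real (Suc M))"
      by (simp only:) (subst ln_mult, auto)
    moreover have "ln (1 + 1 / real (Suc M)) \<le> 1 / real (Suc M)" by (rule ln_add_one_self_le_self) simp
    ultimately show ?thesis using Suc False by simp
  qed simp
qed

text \<open>
  The free digits are \<open>2 * j\<close> with \<open>N \<le> j \<le> N\<^sup>2\<close> and \<open>N\<close> close to \<open>1 / \<epsilon>\<close>. For \<open>s = 1/2 + \<kappa>/2\<close>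
  each summand is at least \<open>1 / (10 * j)\<close> times \<open>exp (- \<kappa> * (ln 40 + 2 * L))\<close>, which for
  \<open>\<kappa> = ln L / (6 * L)\<close> is about \<open>L powr (-1/3)\<close>. The harmonic sum is at least \<open>L\<close>, so the
  total tends to infinity.
\<close>

lemma dim_spectrum_ge_loglog:
  "\<forall>\<^sub>F L in at_top. ereal (1 / 2 + 1 / 12 * (ln L / L)) \<le> dim_spectrum (1 - exp (- L))"
proof -
  have "\<forall>\<^sub>F L :: real in at_top. exp (- L) * (ln 8 + 2 * L) \<le> (1 - exp (- L)) * ln 2" by real_asymp
  moreover have "\<forall>\<^sub>F L :: real in at_top. 1 \<le> L / 10 * exp (- (1 / 6 * (ln L / L) * (ln 40 + 2 * L)))" by real_asymp
  moreover have "\<forall>\<^sub>F L :: real in at_top. 0 \<le> 1 / 6 * (ln L / L)" by real_asymp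
  moreover have "\<forall>\<^sub>F L :: real in at_top. 1 \<le> L" by real_asymp
  ultimately show ?thesis
  proof eventually_elim
    case (elim L)
    define \<kappa> where "\<kappa> = 1 / 6 * (ln L / L)"
    define N where "N = nat \<lceil>exp L\<rceil>"
    define A where "A = (\<lambda>j. 2 * j) ` {N..N\<^sup>2}"
    note \<kappa> = elim(3)[folded \<kappa>_def]
    have N: "exp L \<le> real N" "real N \<le> 2 * exp L"
    proof -
      show "exp L \<le> real N" unfolding N_def by linarith
      have "1 \<le> exp L" using elim by simp
      then show "real N \<le> 2 * exp L" unfolding N_def by linarith
    qed
    then have N0: "0 < N" using exp_gt_zero[of L] by (cases N) auto
    have N2: "real (N\<^sup>2) \<le> 4 * exp (2 * L)"
    proof -
      have "real (N\<^sup>2) \<le> (2 * exp L)\<^sup>2" unfolding of_nat_power using N by (intro power_mono) auto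
      also have "\<dots> = 4 * exp (2 * L)" by (simp add: power_mult_distrib exp_double)
      finally show ?thesis .
    qed
    have A_bounds: "2 * exp L \<le> real a \<and> real a \<le> 8 * exp (2 * L)" if aA: "a \<in> A" for a
    proof -
      obtain j where j: "a = 2 * j" "N \<le> j" "j \<le> N\<^sup>2" using aA by (auto simp: A_def)
      then have "real N \<le> real j" "real j \<le> real (N\<^sup>2)" by (simp_all only: of_nat_le_iff)
      moreover have "real a = 2 * real j" using j by simp
      ultimately show ?thesis using N(1) N2 by linarith
    qed
    interpret steering "1 - exp (- L)" A
    proof
      show "0 < 1 - exp (- L)" "1 - exp (- L) < 1" using elim by auto
      show "finite A" by (simp add: A_def)
      fix a assume a: "a \<in> A"
      have lo: "2 * exp L \<le> real a" and hi: "real a \<le> 8 * exp (2 * L)" using A_bounds[OF a] by auto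
      have pos: "0 < real a" using lo exp_gt_zero[of L] by linarith
      then show "0 < a" by simp
      show "even a" using a by (auto simp: A_def)
      have "exp L \<le> real a" using lo exp_gt_zero[of L] by linarith
      then have ln_lo: "L \<le> ln (real a)" using pos by (simp add: ln_ge_iff)
      have "1 / real a \<le> 1 / exp L" using \<open>exp L \<le> real a\<close> pos by (intro divide_left_mono) auto
      also have "\<dots> = exp (- L) * 1" by (simp add: exp_minus divide_inverse)
      also have "\<dots> \<le> exp (- L) * ln (real a)" using ln_lo elim by (intro mult_left_mono) auto
      finally show "1 / real a \<le> (1 - (1 - exp (- L))) * ln (real a)" by simp
      have "ln (real a) \<le> ln (8 * exp (2 * L))" using hi pos by (subst ln_le_cancel_iff) auto
      also have "\<dots> = ln 8 + 2 * L" by (simp add: ln_mult)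
      finally have "exp (- L) * ln (real a) \<le> exp (- L) * (ln 8 + 2 * L)" by (intro mult_left_mono) auto
      also note elim(1)
      finally show "(1 - (1 - exp (- L))) * ln (real a) \<le> (1 - exp (- L)) * ln 2" by simp
    qed
    have "1 \<le> (\<Sum>a\<in>A. (5 * real a) powr (-2 * (1 / 2 + \<kappa> / 2)))"
    proof -
      have summand: "1 / (10 * real j) * exp (- (\<kappa> * (ln 40 + 2 * L))) \<le> (5 * real (2 * j)) powr (-2 * (1 / 2 + \<kappa> / 2))"
        if j: "j \<in> {N..N\<^sup>2}" for j
      proof -
        have j0: "0 < real j" using j N0 by simp
        have "real j \<le> real (N\<^sup>2)" using j by (simp only: of_nat_le_iff atLeastAtMost_iff)
        then have "10 * real j \<le> 40 * exp (2 * L)" using N2 by linarith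
        then have "ln (10 * real j) \<le> ln (40 * exp (2 * L))" using j0 by (subst ln_le_cancel_iff) auto
        also have "\<dots> = ln 40 + 2 * L" by (simp add: ln_mult)
        finally have "\<kappa> * ln (10 * real j) \<le> \<kappa> * (ln 40 + 2 * L)" using \<kappa> by (intro mult_left_mono)
        then have "exp (- (\<kappa> * (ln 40 + 2 * L))) \<le> (10 * real j) powr (- \<kappa>)"
          using j0 by (simp add: powr_def)
        then have "1 / (10 * real j) * exp (- (\<kappa> * (ln 40 + 2 * L))) \<le> 1 / (10 * real j) * (10 * real j) powr (- \<kappa>)"
          using j0 by (intro mult_left_mono) auto
        also have "\<dots> = (10 * real j) powr (-1 + - \<kappa>)"
          using j0 unfolding powr_add by (simp add: powr_minus_divide)
        also have "\<dots> = (5 * real (2 * j)) powr (-2 * (1 / 2 + \<kappa> / 2))" by (simp add: algebra_simps)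
        finally show ?thesis .
      qed
      have "ln (real N) \<le> ln (real (Suc (N\<^sup>2))) - ln (real N)"
      proof -
        have "2 * ln (real N) = ln (real (N\<^sup>2))" using N0 by (simp add: ln_realpow)
        also have "\<dots> \<le> ln (real (Suc (N\<^sup>2)))"
          using N0 by (subst ln_le_cancel_iff) (auto simp: add_pos_nonneg)
        finally show ?thesis by simp
      qed
      also have "\<dots> \<le> (\<Sum>j=N..N\<^sup>2. 1 / real j)"
        using N0 by (intro ln_le_sum_inverse) (auto simp: power2_eq_square intro: le_SucI)
      finally have harm: "L \<le> (\<Sum>j=N..N\<^sup>2. 1 / real j)"
        using N N0 ln_ge_iff[of "real N" L] by simp
      have "1 \<le> L / 10 * exp (- (\<kappa> * (ln 40 + 2 * L)))" using elim(2) by (simp add: \<kappa>_def)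
      also have "\<dots> \<le> (\<Sum>j=N..N\<^sup>2. 1 / real j) / 10 * exp (- (\<kappa> * (ln 40 + 2 * L)))"
        using harm by (intro mult_right_mono divide_right_mono) auto
      also have "\<dots> = (\<Sum>j=N..N\<^sup>2. 1 / (10 * real j) * exp (- (\<kappa> * (ln 40 + 2 * L))))"
        unfolding sum_divide_distrib sum_distrib_right by (intro sum.cong) (auto simp: field_simps)
      also have "\<dots> \<le> (\<Sum>j=N..N\<^sup>2. (5 * real (2 * j)) powr (-2 * (1 / 2 + \<kappa> / 2)))"
        by (intro sum_mono summand)
      also have "\<dots> = (\<Sum>a\<in>A. (5 * real a) powr (-2 * (1 / 2 + \<kappa> / 2)))"
        unfolding A_def by (subst sum.reindex) (auto simp: inj_on_def)
      finally show ?thesis .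
    qed
    then have "ereal (1 / 2 + \<kappa> / 2) \<le> dim_spectrum (1 - exp (- L))"
      using \<kappa> by (intro dim_spectrum_ge) auto
    then show ?case by (simp add: \<kappa>_def)
  qed
qed

theorem theorem1p10:
  shows "\<exists>c1 c2 :: real. 0 < c1 \<and> c1 \<le> c2 \<and>
    (\<forall>\<^sub>F \<alpha> in at_left (1::real).
       ereal (c1 * (ln (ln (1 / (1 - \<alpha>))) / ln (1 / (1 - \<alpha>)))) \<le> dim_spectrum \<alpha> - ereal (1/2) \<and>
       dim_spectrum \<alpha> - ereal (1/2) \<le> ereal (c2 * (ln (ln (1 / (1 - \<alpha>))) / ln (1 / (1 - \<alpha>)))))"
proof (intro exI conjI)
  have lim: "filterlim (\<lambda>\<alpha>::real. ln (1 / (1 - \<alpha>))) at_top (at_left 1)" by real_asymp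
  have "\<forall>\<^sub>F L in at_top. ereal (1 / 2 + 1 / 12 * (ln L / L)) \<le> dim_spectrum (1 - exp (- L)) \<and>
      dim_spectrum (1 - exp (- L)) \<le> ereal (1 / 2 + 16 * (ln L / L))"
    using dim_spectrum_ge_loglog dim_spectrum_le_loglog by eventually_elim simp
  then have "\<forall>\<^sub>F \<alpha> in at_left 1. ereal (1 / 2 + 1 / 12 * (ln (ln (1 / (1 - \<alpha>))) / ln (1 / (1 - \<alpha>))))
        \<le> dim_spectrum (1 - exp (- ln (1 / (1 - \<alpha>)))) \<and>
      dim_spectrum (1 - exp (- ln (1 / (1 - \<alpha>)))) \<le> ereal (1 / 2 + 16 * (ln (ln (1 / (1 - \<alpha>))) / ln (1 / (1 - \<alpha>))))"
    by (rule eventually_compose_filterlim[OF _ lim])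
  moreover have "\<forall>\<^sub>F \<alpha> in at_left (1::real). \<alpha> < 1" by (simp add: eventually_at_filter)
  ultimately show "\<forall>\<^sub>F \<alpha> in at_left (1::real).
       ereal (1 / 12 * (ln (ln (1 / (1 - \<alpha>))) / ln (1 / (1 - \<alpha>)))) \<le> dim_spectrum \<alpha> - ereal (1/2) \<and>
       dim_spectrum \<alpha> - ereal (1/2) \<le> ereal (16 * (ln (ln (1 / (1 - \<alpha>))) / ln (1 / (1 - \<alpha>))))"
  proof eventually_elim
    case (elim \<alpha>)
    then have "1 - exp (- ln (1 / (1 - \<alpha>))) = \<alpha>" by (simp add: ln_div)
    with elim show ?case by (cases "dim_spectrum \<alpha>") auto
  qed
qed auto

end
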